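(* Let $l\ge 3$ be an integer. For each integer $m\ge 1$ let $\epsilon_m\in(0,\tfrac12)$ satisfy $2^{m^2}\epsilon_m<\tfrac12$, and let $u_{1,m},\dots,u_{l-2,m}\in F$ be elements with $\mathrm{Support}(u_{i,m})\subseteq[0,\epsilon_m)$ for $1\le i\le l-2$ such that for every nontrivial reduced word $w=w(a,b_1,\dots,b_{l-2})$ of length at most $2m^2$ in the free group $F(a,b_1,\dots,b_{l-2})$ of rank $l-1$, the homeomorphism $w(x_0,u_{1,m},\dots,u_{l-2,m})$ is not the identity on $[0,\epsilon_m)$. (Such elements exist.) Then the sequence of marked groups $$G_m=\bigl(F,\{x_0,\;x_0^m u_{1,m}^m x_1,\;u_{1,m},\dots,u_{l-2,m}\}\bigr)$$ converges, as $m\to\infty$, in the space $\mathcal G_l$ of $l$-generator marked groups to the free group of rank $l$ marked by a free basis, $(F_l,\{a_1,a_2,\dots,a_l\})$.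
   Context: Thompson's group $F$ is the group of orientation-preserving piecewise-linear homeomorphisms of $[0,1]$ whose breakpoints have dyadic rational coordinates and whose slopes are powers of $2$; the product is composition, $(fg)(t)=f(g(t))$. The support of $f\in F$ is the closure of $\{t: f(t)\neq t\}$. The element $x_0$ maps $[0,\frac12]$, $[\frac12,\frac34]$, $[\frac34,1]$ linearly and increasingly onto $[0,\frac14]$, $[\frac14,\frac12]$, $[\frac12,1]$ respectively. For $n\ge1$, $x_n$ is the identity on $[0,1-2^{-n}]$ and $x_n(t)=1-2^{-n}+2^{-n}x_0\bigl(2^n(t-1+2^{-n})\bigr)$ on $[1-2^{-n},1]$. The elements $x_0,x_1$ generate $F$. For a word $w$ in a free group, $w(g_1,\dots,g_k)$ denotes the element obtained by substituting $g_i$ for the $i$-th free generator. A marked group $(G,S)$ is a group $G$ with a fixed ordered finite generating set $S$; $\mathcal G_l$ is the set of groups marked by $l$ elements, up to isomorphism of marked groups. Identifying generators of each marked group with a fixed basis of the free group of rank $l$, two marked groups in $\mathcal G_l$ are at distance at most $e^{-R}$ if they have the same relations (words representing the identity) of length at most $R$; convergence is with respect to this topology. Equivalently, $(\Gamma_m,S_m)\to(\Gamma,S)$ if and only if every word $w$ in the free group of rank $l$ that is trivial in $\Gamma$ is trivial in $\Gamma_m$ for all large $m$, and every $w$ that is trivial in $\Gamma_m$ for infinitely many $m$ is trivial in $\Gamma$. *)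

theory Defs
  imports
    "HOL-Analysis.Analysis"
    "HOL-Algebra.Bij"
    "HOL-Algebra.Generated_Groups"
begin

section \<open>Free groups and words\<close>

text \<open>
  The letter \<open>(i, True)\<close> stands for the free generator of index \<open>i\<close> and \<open>(i, False)\<close> for its
  inverse; the generators of the free group of rank \<open>k\<close> have the indices \<open>0, \<dots>, k - 1\<close>.
  Elements of the free group are the reduced words, so that \<open>length\<close> is the word length.
\<close>

type_synonym letter = "nat \<times> bool"

definition inv_letter :: "letter \<Rightarrow> letter" where
  "inv_letter x = (fst x, \<not> snd x)"

definition reduced :: "letter list \<Rightarrow> bool" where
  "reduced w \<longleftrightarrow> successively (\<lambda>x y. y \<noteq> inv_letter x) w"

fun cancel_cons :: "letter \<Rightarrow> letter list \<Rightarrow> letter list" where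
  "cancel_cons x [] = [x]"
| "cancel_cons x (y # w) = (if y = inv_letter x then w else x # y # w)"

definition free_group :: "nat \<Rightarrow> letter list monoid" where
  "free_group k =
     \<lparr>carrier = {w. reduced w \<and> fst ` set w \<subseteq> {..<k}},
      mult = (\<lambda>v w. foldr cancel_cons v w),
      one = []\<rparr>"

definition free_basis :: "nat \<Rightarrow> letter list list" where
  "free_basis k = map (\<lambda>i. [(i, True)]) [0..<k]"

definition word_eval :: "('a, 'b) monoid_scheme \<Rightarrow> 'a list \<Rightarrow> letter list \<Rightarrow> 'a" where
  "word_eval G gs w =
     foldr (\<lambda>(i, s) g. (if s then gs ! i else inv\<^bsub>G\<^esub> (gs ! i)) \<otimes>\<^bsub>G\<^esub> g) w \<one>\<^bsub>G\<^esub>"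


section \<open>The space of marked groups\<close>

type_synonym 'a marked = "'a monoid \<times> 'a list"

definition marked_group :: "nat \<Rightarrow> 'a marked \<Rightarrow> bool" where
  "marked_group l X \<longleftrightarrow>
     group (fst X) \<and> length (snd X) = l \<and> set (snd X) \<subseteq> carrier (fst X) \<and>
     generate (fst X) (set (snd X)) = carrier (fst X)"

definition relations :: "nat \<Rightarrow> 'a marked \<Rightarrow> letter list set" where
  "relations l X = {w \<in> carrier (free_group l). word_eval (fst X) (snd X) w = \<one>\<^bsub>fst X\<^esub>}"

definition same_relations_upto :: "nat \<Rightarrow> nat \<Rightarrow> 'a marked \<Rightarrow> 'b marked \<Rightarrow> bool" where
  "same_relations_upto l R X Y \<longleftrightarrow>
     {w \<in> relations l X. length w \<le> R} = {w \<in> relations l Y. length w \<le> R}"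

text \<open>
  The two arguments may have different carrier types. Points of the space of marked groups are
  isomorphism classes; the distance only depends on the relations, hence only on these classes.
  The set is nonempty (the two groups always agree on words of length \<open>0\<close>) and bounded below.
\<close>

definition marked_dist :: "nat \<Rightarrow> 'a marked \<Rightarrow> 'b marked \<Rightarrow> real" where
  "marked_dist l X Y = Inf {exp (- real R) | R. same_relations_upto l R X Y}"

lemma same_relations_upto_mono:
  "same_relations_upto l R X Y \<Longrightarrow> R' \<le> R \<Longrightarrow> same_relations_upto l R' X Y"
  unfolding same_relations_upto_def set_eq_iff mem_Collect_eq using le_trans by blast

lemma same_relations_upto_0: "same_relations_upto l 0 X Y"
  by (auto simp: same_relations_upto_def relations_def free_group_def reduced_def word_eval_def)

lemma marked_dist_le_iff:
  "marked_dist l X Y \<le> exp (- real R) \<longleftrightarrow> same_relations_upto l R X Y"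
proof
  let ?A = "{exp (- real R) | R. same_relations_upto l R X Y}"
  assume le: "marked_dist l X Y \<le> exp (- real R)"
  show "same_relations_upto l R X Y"
  proof (rule ccontr)
    assume no: "\<not> same_relations_upto l R X Y"
    have "Inf ?A < exp (1 - real R)"
      using le exp_less_mono[of "- real R" "1 - real R"] unfolding marked_dist_def by linarith
    moreover have "?A \<noteq> {}"
      using same_relations_upto_0[of l X Y] by blast
    ultimately obtain R' where R': "same_relations_upto l R' X Y"
      and "exp (- real R') < exp (1 - real R)"
      using cInf_lessD[of ?A "exp (1 - real R)"] by auto
    then have "R \<le> R'" by simp
    with R' no show False using same_relations_upto_mono by blast
  qed
next
  assume "same_relations_upto l R X Y"
  then show "marked_dist l X Y \<le> exp (- real R)"
    unfolding marked_dist_def by (intro cInf_lower) (auto intro!: bdd_belowI[of _ 0])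
qed


section \<open>Thompson's group \<open>F\<close>\<close>

text \<open>
  \<open>B\<close> contains the breakpoints of \<open>f\<close>, and \<open>f\<close> is affine between consecutive points of \<open>B\<close>.
\<close>

definition dyadic_PL :: "(real \<Rightarrow> real) \<Rightarrow> bool" where
  "dyadic_PL f \<longleftrightarrow>
     (\<exists>B. finite B \<and> {0, 1} \<subseteq> B \<and> B \<subseteq> {0..1} \<and> (\<forall>b\<in>B. b \<in> dyadics \<and> f b \<in> dyadics) \<and>
        (\<forall>a\<in>B. \<forall>b\<in>B. a < b \<and> {a<..<b} \<inter> B = {} \<longrightarrow>
           (\<exists>k::int. \<forall>t\<in>{a..b}. f t = f a + 2 powi k * (t - a))))"

text \<open>
  Elements are extensional functions on \<open>[0, 1]\<close>, as in \<^const>\<open>BijGroup\<close>; the product is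
  composition, \<open>(f g)(t) = f (g t)\<close>.
\<close>

definition thompson_F :: "(real \<Rightarrow> real) monoid" where
  "thompson_F = (BijGroup {0..1})
     \<lparr>carrier := {f \<in> Bij {0..1}. (\<exists>g. homeomorphism {0..1} {0..1} f g) \<and>
                    strict_mono_on {0..1} f \<and> dyadic_PL f}\<rparr>"

definition support :: "(real \<Rightarrow> real) \<Rightarrow> real set" where
  "support f = closure {t \<in> {0..1}. f t \<noteq> t}"

definition thompson_x0 :: "real \<Rightarrow> real" where
  "thompson_x0 = (\<lambda>t\<in>{0..1}. if t \<le> 1/2 then t / 2 else if t \<le> 3/4 then t - 1/4 else 2 * t - 1)"

text \<open>For \<open>n = 0\<close> the following formula gives \<^const>\<open>thompson_x0\<close> again.\<close>

definition thompson_x :: "nat \<Rightarrow> real \<Rightarrow> real" where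
  "thompson_x n = (\<lambda>t\<in>{0..1}. if t \<le> 1 - 1 / 2 ^ n then t
     else 1 - 1 / 2 ^ n + 1 / 2 ^ n * thompson_x0 (2 ^ n * (t - 1 + 1 / 2 ^ n)))"


section \<open>The sequence of markings\<close>

text \<open>
  The generator of index \<open>0\<close> is \<open>a\<close>, and the one of index \<open>i \<ge> 1\<close> is \<open>b\<^sub>i\<close>. Only the values
  \<open>u 1, \<dots>, u (l - 2)\<close> matter.
\<close>

definition admissible :: "nat \<Rightarrow> nat \<Rightarrow> real \<Rightarrow> (nat \<Rightarrow> real \<Rightarrow> real) \<Rightarrow> bool" where
  "admissible l m e u \<longleftrightarrow>
     (\<forall>i\<in>{1..l-2}. u i \<in> carrier thompson_F \<and> support (u i) \<subseteq> {0..<e}) \<and>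
     (\<forall>w\<in>carrier (free_group (l - 1)). w \<noteq> \<one>\<^bsub>free_group (l - 1)\<^esub> \<and> length w \<le> 2 * m\<^sup>2 \<longrightarrow>
        (\<exists>t\<in>{0..<e}. word_eval thompson_F (thompson_x0 # map u [1..<l-1]) w t \<noteq> t))"

definition F_marking :: "nat \<Rightarrow> nat \<Rightarrow> (nat \<Rightarrow> real \<Rightarrow> real) \<Rightarrow> (real \<Rightarrow> real) marked" where
  "F_marking l m u =
     (thompson_F,
      [thompson_x0,
       thompson_x0 [^]\<^bsub>thompson_F\<^esub> m \<otimes>\<^bsub>thompson_F\<^esub> u 1 [^]\<^bsub>thompson_F\<^esub> m \<otimes>\<^bsub>thompson_F\<^esub> thompson_x 1]
      @ map u [1..<l-1])"

end

theory Submission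
  imports Defs
begin

text \<open>
  On \<open>[0, 1/2]\<close> the element \<open>x\<^sub>1\<close> is the identity, and \<open>x\<^sub>0\<^sup>-\<^sup>1\<close> at most doubles a point. Hence, for
  \<open>m\<close> larger than the length of a word \<open>w\<close>, a point of \<open>[0, \<epsilon>\<^sub>m)\<close> never leaves \<open>[0, 1/2]\<close> while \<open>w\<close>
  is applied to it, and there \<open>w\<close> acts as the word in \<open>x\<^sub>0, u\<^sub>1, \<dots>\<close> that arises from the
  substitution \<open>a\<^sub>2 \<mapsto> a\<^sup>m b\<^sub>1\<^sup>m\<close>. That word stays nontrivial after reduction, since the short
  syllables of \<open>w\<close> cannot absorb the long ones, so it moves a point by the choice of the \<open>u\<^sub>i\<close>.

  Suitable \<open>u\<^sub>i\<close> exist because increasing maps can be prescribed on finitely many dyadic points: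
  all words of bounded length are made to act nontrivially by giving each its own path of points
  near \<open>0\<close>. Finally, \<open>x\<^sub>0\<close> and \<open>x\<^sub>1\<close> generate \<open>F\<close> since every standard dyadic partition is
  obtained by splitting intervals, and precomposition with \<open>x\<^sub>n\<close> splits the \<open>n\<close>-th interval.
\<close>

section \<open>Words and free groups\<close>

text \<open>The constants in \<open>admissible\<close> fit the substitution: a word of length below
  m expands to at most 2m * m letters, and at most m * m of them are inverses of
  \<open>thompson_x0\<close>, the only letters that raise the bound on the orbit, each by a factor
  of at most 2. A power of a single generator in place of a^m b_1^m would not do: the commutator
  with that generator would be sent to a word that reduces to the empty one. With two powers, each
  half of the image shields the other from its neighbours. The factor x_1 is what lets the tuple
  generate F, and it is invisible near 0. Words are evaluated as right-nested products and the
  product is composition, so a word acts from its last letter on. Inductions on words therefore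
  split off the first letter, and the remaining suffix determines the point reached so far.
  Piecewise linear maps are treated through the inductive predicate \<open>dpl\<close> and not
  through breakpoint sets: cutting, composing and inverting them become inductions over the
  pieces.\<close>

lemma inv_letter_inv_letter [simp]: "inv_letter (inv_letter x) = x"
  by (simp add: inv_letter_def prod_eq_iff)

lemma fst_inv_letter [simp]: "fst (inv_letter x) = fst x"
  by (simp add: inv_letter_def)

lemma inv_letter_Pair [simp]: "inv_letter (i, s) = (i, \<not> s)"
  by (simp add: inv_letter_def)

lemma reduced_Nil [simp]: "reduced []"
  by (simp add: reduced_def)

lemma reduced_Cons: "reduced (x # w) \<longleftrightarrow> reduced w \<and> (w = [] \<or> hd w \<noteq> inv_letter x)"
  unfolding reduced_def by (cases w) auto

lemma reduced_append: "reduced (u @ v) \<Longrightarrow> reduced u \<and> reduced v"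
  unfolding reduced_def by (auto simp: successively_append_iff)

lemma reduced_cancel_cons: "reduced w \<Longrightarrow> reduced (cancel_cons x w)"
  by (cases w) (auto simp: reduced_Cons)

lemma cancel_cons_reduced: "reduced (x # w) \<Longrightarrow> cancel_cons x w = x # w"
  by (cases w) (auto simp: reduced_Cons)

lemma reduced_foldr_cancel_cons: "reduced w \<Longrightarrow> reduced (foldr cancel_cons v w)"
  by (induction v) (auto simp: reduced_cancel_cons)

lemma cancel_cons_inv_letter: "reduced w \<Longrightarrow> cancel_cons x (cancel_cons (inv_letter x) w) = w"
  by (cases w) (auto simp: reduced_Cons cancel_cons_reduced)

text \<open>Van der Waerden's argument for associativity: letters act on reduced words from the
  left, and \<open>inv_letter x\<close> acts as the inverse of \<open>x\<close>. A cancellation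
  inside \<open>v\<close> may therefore be carried out after \<open>v\<close> has acted on
  \<open>w\<close>.\<close>

lemma foldr_cancel_cons_cancel_cons:
  assumes "reduced v" "reduced w"
  shows "foldr cancel_cons (cancel_cons x v) w = cancel_cons x (foldr cancel_cons v w)"
proof (cases v)
  case (Cons y v')
  then show ?thesis
    using assms cancel_cons_inv_letter[OF reduced_foldr_cancel_cons[of w v']] by auto
qed simp

lemma foldr_cancel_cons_assoc:
  assumes "reduced v" "reduced w"
  shows "foldr cancel_cons (foldr cancel_cons u v) w = foldr cancel_cons u (foldr cancel_cons v w)"
  using assms
  by (induction u) (auto simp: foldr_cancel_cons_cancel_cons reduced_foldr_cancel_cons)

lemma set_cancel_cons: "set (cancel_cons x w) \<subseteq> insert x (set w)"
  by (cases w) auto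

lemma set_foldr_cancel_cons: "set (foldr cancel_cons v w) \<subseteq> set v \<union> set w"
  by (induction v) (use set_cancel_cons in fastforce)+

lemma length_cancel_cons: "length (cancel_cons x w) \<le> Suc (length w)"
  by (cases w) auto

lemma length_foldr_cancel_cons: "length (foldr cancel_cons v w) \<le> length v + length w"
  by (induction v) (auto intro: order_trans[OF length_cancel_cons])

lemma foldr_cancel_cons_inv:
  "reduced v \<Longrightarrow> foldr cancel_cons (rev (map inv_letter v)) v = []"
  by (induction v) (auto simp: reduced_Cons)

lemma group_free_group: "group (free_group k)"
proof (rule groupI)
  fix x assume x: "x \<in> carrier (free_group k)"
  \<comment> \<open>Multiplying the reversed word of inverse letters into \<open>[]\<close> makes
    the candidate reduced by construction.\<close>
  let ?y = "foldr cancel_cons (rev (map inv_letter x)) []"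
  have "set ?y \<subseteq> inv_letter ` set x"
    using set_foldr_cancel_cons[of "rev (map inv_letter x)" "[]"] by auto
  then have "?y \<in> carrier (free_group k)"
    using x by (fastforce simp: free_group_def reduced_foldr_cancel_cons)
  moreover have "?y \<otimes>\<^bsub>free_group k\<^esub> x = \<one>\<^bsub>free_group k\<^esub>"
    using x foldr_cancel_cons_assoc[of "[]" x "rev (map inv_letter x)"]
    by (simp add: free_group_def foldr_cancel_cons_inv)
  ultimately show "\<exists>y\<in>carrier (free_group k). y \<otimes>\<^bsub>free_group k\<^esub> x = \<one>\<^bsub>free_group k\<^esub>" by blast
next
  fix x y assume xy: "x \<in> carrier (free_group k)" "y \<in> carrier (free_group k)"
  then show "x \<otimes>\<^bsub>free_group k\<^esub> y \<in> carrier (free_group k)"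
    using set_foldr_cancel_cons[of x y]
    by (fastforce simp: free_group_def reduced_foldr_cancel_cons)
qed (auto simp: free_group_def foldr_cancel_cons_assoc)

section \<open>Evaluation of words in a group\<close>

context group
begin

lemma word_eval_Nil [simp]: "word_eval G gs [] = \<one>"
  by (simp add: word_eval_def)

lemma word_eval_Cons [simp]:
  "word_eval G gs (x # w) =
     (if snd x then gs ! fst x else inv (gs ! fst x)) \<otimes> word_eval G gs w"
  by (simp add: word_eval_def case_prod_beta)

lemma word_eval_closed:
  "set gs \<subseteq> carrier G \<Longrightarrow> fst ` set w \<subseteq> {..<length gs} \<Longrightarrow> word_eval G gs w \<in> carrier G"
  by (induction w) (auto simp: subset_iff)

lemma word_eval_append:
  assumes "set gs \<subseteq> carrier G" "fst ` set (u @ v) \<subseteq> {..<length gs}"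
  shows "word_eval G gs (u @ v) = word_eval G gs u \<otimes> word_eval G gs v"
  using assms
proof (induction u)
  case (Cons x u)
  then have "gs ! fst x \<in> carrier G" "word_eval G gs u \<in> carrier G" "word_eval G gs v \<in> carrier G"
    by (auto intro!: word_eval_closed)
  with Cons show ?case by (auto simp: m_assoc)
next
  case Nil
  then show ?case by (simp add: word_eval_closed)
qed

lemma word_eval_cancel_cons:
  assumes "set gs \<subseteq> carrier G" "fst ` set (x # w) \<subseteq> {..<length gs}"
  shows "word_eval G gs (cancel_cons x w) = word_eval G gs (x # w)"
proof (cases w)
  case (Cons y v)
  with assms have "gs ! fst x \<in> carrier G" "word_eval G gs v \<in> carrier G"
    by (auto intro!: word_eval_closed)
  with Cons show ?thesis by (auto simp: inv_letter_def inv_solve_left' m_assoc[symmetric])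
qed simp

lemma word_eval_foldr_cancel_cons:
  assumes "set gs \<subseteq> carrier G" "fst ` set w \<subseteq> {..<length gs}"
  shows "word_eval G gs (foldr cancel_cons w []) = word_eval G gs w"
  using assms(2)
proof (induction w)
  case (Cons x w)
  then have "fst ` set (x # foldr cancel_cons w []) \<subseteq> {..<length gs}"
    using set_foldr_cancel_cons[of w "[]"] by auto
  with Cons show ?case using assms(1) by (simp add: word_eval_cancel_cons)
qed simp

lemma word_eval_replicate:
  assumes "set gs \<subseteq> carrier G" "i < length gs"
  shows "word_eval G gs (replicate n (i, s)) = (if s then gs ! i else inv (gs ! i)) [^] n"
proof -
  have "gs ! i \<in> carrier G" using assms by auto
  then show ?thesis by (induction n) (auto simp: nat_pow_Suc2[symmetric])
qed

end

lemma inv_free_basis: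
  assumes "i < k" shows "inv\<^bsub>free_group k\<^esub> [(i, True)] = [(i, False)]"
proof -
  interpret group "free_group k" by (rule group_free_group)
  show ?thesis using assms by (intro inv_equality) (auto simp: free_group_def reduced_Cons)
qed

text \<open>This makes the empty word the only relation of the free marked group, so convergence
  amounts to excluding nonempty relations of bounded length.\<close>

lemma word_eval_free_basis:
  assumes "w \<in> carrier (free_group k)"
  shows "word_eval (free_group k) (free_basis k) w = w"
proof -
  interpret group "free_group k" by (rule group_free_group)
  have "reduced w \<Longrightarrow> fst ` set w \<subseteq> {..<k} \<Longrightarrow> word_eval (free_group k) (free_basis k) w = w" for w
  proof (induction w)
    case (Cons x w)
    then have "(if snd x then free_basis k ! fst x else inv\<^bsub>free_group k\<^esub> (free_basis k ! fst x)) = [x]"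
      by (cases x) (auto simp: free_basis_def inv_free_basis)
    then have "word_eval (free_group k) (free_basis k) (x # w) = foldr cancel_cons [x] w"
      using Cons by (simp add: reduced_Cons) (simp add: free_group_def)
    with Cons show ?case by (simp add: cancel_cons_reduced)
  next
    case Nil
    show ?case by simp (simp add: free_group_def)
  qed
  then show ?thesis using assms by (simp add: free_group_def)
qed

lemma (in group) word_eval_in_generate:
  assumes "fst ` set w \<subseteq> {..<length gs}"
  shows "word_eval G gs w \<in> generate G (set gs)"
  using assms by (induction w) (auto intro!: generate.one generate.eng intro: generate.incl generate.inv)

lemma marked_group_free_group: "marked_group k (free_group k, free_basis k)"
proof -
  interpret group "free_group k" by (rule group_free_group)
  have sub: "set (free_basis k) \<subseteq> carrier (free_group k)"
    by (auto simp: free_basis_def free_group_def reduced_Cons)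
  have "w \<in> generate (free_group k) (set (free_basis k))" if "w \<in> carrier (free_group k)" for w
    using word_eval_in_generate[of w "free_basis k"] that
    by (simp add: word_eval_free_basis) (simp add: free_group_def free_basis_def)
  then show ?thesis
    using sub generate_incl[OF sub]
    by (auto simp: marked_group_def group_free_group free_basis_def)
qed

section \<open>Dyadic piecewise linear maps between intervals\<close>

text \<open>The numerators in \<open>dyadics\<close> are natural numbers; integer numerators make
  the predicate closed under subtraction.\<close>

definition dyad :: "real \<Rightarrow> bool" where
  "dyad x \<longleftrightarrow> (\<exists>(p::int) (n::nat). x = of_int p / 2 ^ n)"

lemma dyad_iff_dyadics: "0 \<le> x \<Longrightarrow> x \<in> dyadics \<longleftrightarrow> dyad x"
proof
  assume "0 \<le> x" "dyad x"
  then obtain p :: int and n :: nat where x: "x = of_int p / 2 ^ n"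
    by (auto simp: dyad_def)
  with \<open>0 \<le> x\<close> have "0 \<le> p" by (simp add: field_simps)
  with x have "x = of_nat (nat p) / 2 ^ n" by simp
  then show "x \<in> dyadics" unfolding dyadics_def by blast
next
  assume "x \<in> dyadics"
  then obtain k and m :: nat where "x = of_int (int m) / 2 ^ k" by (auto simp: dyadics_def)
  then show "dyad x" unfolding dyad_def by blast
qed

text \<open>Every large exponent serves as denominator, so finitely many dyadic numbers can be put
  on one grid.\<close>

lemma dyadE:
  assumes "dyad x"
  obtains n where "\<And>k. k \<ge> n \<Longrightarrow> \<exists>p::int. x = of_int p / 2 ^ k"
proof -
  obtain p :: int and n :: nat where x: "x = of_int p / 2 ^ n" using assms by (auto simp: dyad_def)
  have "\<exists>q::int. x = of_int q / 2 ^ k" if "k \<ge> n" for k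
  proof -
    have "(2::real) ^ k = 2 ^ n * 2 ^ (k - n)" using that by (simp flip: power_add)
    then have "x = of_int (p * 2 ^ (k - n)) / 2 ^ k" using x by simp
    then show ?thesis by blast
  qed
  then show thesis using that by blast
qed

lemma dyad_of_int [simp]: "dyad (of_int p)"
  unfolding dyad_def by (intro exI[of _ p] exI[of _ 0]) simp

lemma dyad_0 [simp]: "dyad 0" and dyad_1 [simp]: "dyad 1"
  using dyad_of_int[of 0] dyad_of_int[of 1] by simp_all

lemma dyad_add:
  assumes "dyad x" "dyad y" shows "dyad (x + y)"
proof -
  obtain n m where n: "\<And>k. k \<ge> n \<Longrightarrow> \<exists>p::int. x = of_int p / 2 ^ k"
    and m: "\<And>k. k \<ge> m \<Longrightarrow> \<exists>p::int. y = of_int p / 2 ^ k"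
    using assms by (metis dyadE)
  obtain p q :: int where "x = of_int p / 2 ^ max n m" "y = of_int q / 2 ^ max n m"
    using n[of "max n m"] m[of "max n m"] by auto
  then have "x + y = of_int (p + q) / 2 ^ max n m" by (simp add: add_divide_distrib)
  then show ?thesis unfolding dyad_def by blast
qed

lemma dyad_mult: "dyad x \<Longrightarrow> dyad y \<Longrightarrow> dyad (x * y)"
  unfolding dyad_def
proof (elim exE)
  fix p q :: int and m n :: nat
  assume "x = of_int p / 2 ^ m" "y = of_int q / 2 ^ n"
  then have "x * y = of_int (p * q) / 2 ^ (m + n)" by (simp add: power_add)
  then show "\<exists>(p::int) (n::nat). x * y = of_int p / 2 ^ n" by blast
qed

lemma dyad_minus: "dyad x \<Longrightarrow> dyad (- x)"
  using dyad_mult[of "- 1" x] dyad_of_int[of "- 1"] by simp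

lemma dyad_diff: "dyad x \<Longrightarrow> dyad y \<Longrightarrow> dyad (x - y)"
  using dyad_add[of x "- y"] dyad_minus[of y] by simp

lemma dyad_div_power2: "dyad (of_int p / 2 ^ n)"
  unfolding dyad_def by blast

lemma dyad_power_int: "dyad (2 powi k)"
proof (cases "k \<ge> 0")
  case True
  then show ?thesis using dyad_of_int[of "2 ^ nat k"] by (simp add: power_int_def)
next
  case False
  then show ?thesis
    using dyad_div_power2[of 1 "nat (- k)"] by (simp add: power_int_def power_inverse field_simps)
qed

lemmas dyad_intros = dyad_add dyad_diff dyad_mult dyad_power_int

text \<open>
  The values of \<open>f\<close> outside the domain \<open>[a, b]\<close> are irrelevant; \<open>[c, d]\<close> is the range.
\<close>

inductive dpl :: "(real \<Rightarrow> real) \<Rightarrow> real \<Rightarrow> real \<Rightarrow> real \<Rightarrow> real \<Rightarrow> bool"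
  for f :: "real \<Rightarrow> real" where
  affine: "a < b \<Longrightarrow> dyad a \<Longrightarrow> dyad b \<Longrightarrow> dyad c \<Longrightarrow> dyad d \<Longrightarrow> d - c = 2 powi k * (b - a) \<Longrightarrow>
    (\<And>t. t \<in> {a..b} \<Longrightarrow> f t = c + 2 powi k * (t - a)) \<Longrightarrow> dpl f a b c d"
| glue: "dpl f a b c d \<Longrightarrow> dpl f b e d h \<Longrightarrow> dpl f a e c h"

section \<open>Order, range and continuity of glued affine maps\<close>

lemma dplD:
  assumes "dpl f a b c d"
  shows "a < b" "c < d" "dyad a" "dyad b" "dyad c" "dyad d" "f a = c" "f b = d"
proof -
  have "a < b \<and> c < d \<and> dyad a \<and> dyad b \<and> dyad c \<and> dyad d \<and> f a = c \<and> f b = d"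
    using assms
  proof induction
    case (affine a b c d k)
    have "0 < 2 powi k * (b - a)" using affine by simp
    then have "c < d" using affine(6) by linarith
    then show ?case using affine by auto
  qed auto
  then show "a < b" "c < d" "dyad a" "dyad b" "dyad c" "dyad d" "f a = c" "f b = d" by auto
qed

lemma dpl_cong:
  assumes "dpl f a b c d" "\<And>t. t \<in> {a..b} \<Longrightarrow> g t = f t"
  shows "dpl g a b c d"
  using assms
proof induction
  case (affine a b c d k)
  then show ?case by (intro dpl.affine) auto
next
  case (glue a b c d e h)
  then have "a < b" "b < e" by (auto dest: dplD)
  then have "dpl g a b c d" "dpl g b e d h" using glue by auto
  then show ?case by (rule dpl.glue)
qed

lemma dpl_less: "dpl f a b c d \<Longrightarrow> a \<le> x \<Longrightarrow> x < y \<Longrightarrow> y \<le> b \<Longrightarrow> f x < f y"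
proof (induction arbitrary: x y rule: dpl.induct)
  case (glue a b c d e h)
  have ab: "a < b" "b < e" using glue(1,2) by (auto dest: dplD)
  consider "y \<le> b" | "b \<le> x" | "x < b" "b < y" by linarith
  then show ?case
  proof cases
    case 1
    then show ?thesis using glue.IH(1) glue.prems by blast
  next
    case 2
    then show ?thesis using glue.IH(2) glue.prems by blast
  next
    case 3
    then have "f x < f b" "f b < f y" using glue.IH glue.prems ab by auto
    then show ?thesis by simp
  qed
qed auto

lemma dpl_le: "dpl f a b c d \<Longrightarrow> a \<le> x \<Longrightarrow> x \<le> y \<Longrightarrow> y \<le> b \<Longrightarrow> f x \<le> f y"
  using dpl_less[of f a b c d x y] by (cases "x = y") auto

lemma dpl_strict_mono_on: "dpl f a b c d \<Longrightarrow> strict_mono_on {a..b} f"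
  by (auto simp: strict_mono_on_def dpl_less)

lemma dpl_range:
  assumes "dpl f a b c d" "x \<in> {a..b}" shows "f x \<in> {c..d}"
  using dpl_le[OF assms(1), of a x] dpl_le[OF assms(1), of x b] dplD[OF assms(1)] assms(2) by auto

lemma dpl_surj: "dpl f a b c d \<Longrightarrow> y \<in> {c..d} \<Longrightarrow> \<exists>x\<in>{a..b}. f x = y"
proof (induction arbitrary: y rule: dpl.induct)
  case (affine a b c d k)
  let ?x = "a + (y - c) / 2 powi k"
  have "0 \<le> (y - c) / 2 powi k" "(y - c) / 2 powi k \<le> b - a"
    using affine by (auto simp: field_simps)
  then have "?x \<in> {a..b}" by auto
  then show ?case using affine by (intro bexI[of _ ?x]) auto
next
  case (glue a b c d e h)
  then have ab: "a < b" "b < e" by (auto dest: dplD)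
  consider "y \<in> {c..d}" | "y \<in> {d..h}" using glue.prems by force
  then obtain x where "x \<in> {a..b} \<union> {b..e}" "f x = y" using glue.IH by cases blast+
  then show ?case using ab by (intro bexI[of _ x]) auto
qed

lemma dpl_bij_betw: "dpl f a b c d \<Longrightarrow> bij_betw f {a..b} {c..d}"
  using dpl_surj[of f a b c d] dpl_range[of f a b c d] dpl_strict_mono_on[of f a b c d]
  unfolding bij_betw_def by (blast intro: strict_mono_on_imp_inj_on)

lemma dpl_continuous_on: "dpl f a b c d \<Longrightarrow> continuous_on {a..b} f"
proof (induction rule: dpl.induct)
  case (affine a b c d k)
  have "continuous_on {a..b} (\<lambda>t. c + 2 powi k * (t - a))" by (intro continuous_intros)
  then show ?case using affine by (subst continuous_on_cong) auto
next
  case (glue a b c d e h)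
  then have "a < b" "b < e" by (auto dest: dplD)
  then have "{a..e} = {a..b} \<union> {b..e}" by auto
  then show ?case using glue by (simp add: continuous_on_closed_Un)
qed

text \<open>Needed for composition: the image of a breakpoint of the inner map is usually no
  breakpoint of the outer map, which has to be cut there first.\<close>

lemma dpl_split:
  assumes "dpl g c d e h" "c < x" "x < d" "dyad x"
  shows "dpl g c x e (g x) \<and> dpl g x d (g x) h"
  using assms
proof (induction)
  case (affine a b c d k)
  then have g: "g x = c + 2 powi k * (x - a)" by auto
  have "dpl g a x c (g x)"
    using affine g by (intro dpl.affine[of _ _ _ _ k]) (auto intro!: dyad_intros)
  moreover have "dpl g x b (g x) d"
  proof (rule dpl.affine[of _ _ _ _ k])
    show "dyad (g x)" using affine g by (auto intro!: dyad_intros)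
    show "d - g x = 2 powi k * (b - x)" using affine.hyps(6) g by (simp add: algebra_simps)
    show "g t = g x + 2 powi k * (t - x)" if "t \<in> {x..b}" for t
      using affine.hyps(7)[of t] affine.prems that g by (simp add: algebra_simps)
  qed (use affine in auto)
  ultimately show ?case by blast
next
  case (glue a b c d e h)
  consider "x < b" | "x = b" | "x > b" by linarith
  then show ?case
  proof cases
    case 1
    then show ?thesis using glue.IH(1) glue.prems glue.hyps dpl.glue by blast
  next
    case 2
    then show ?thesis using glue.hyps dplD(8)[OF glue.hyps(1)] by simp
  next
    case 3
    then show ?thesis using glue.IH(2) glue.prems glue.hyps dpl.glue by blast
  qed
qed

lemma dpl_affine_comp:
  assumes "dpl g c d e h" "d - c = 2 powi k * (b - a)" "dyad a" "dyad b"
    "\<And>t. t \<in> {a..b} \<Longrightarrow> f t = c + 2 powi k * (t - a)"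
  shows "dpl (\<lambda>t. g (f t)) a b e h"
  using assms
proof (induction arbitrary: a b)
  case (affine c d e h j)
  have k: "(2::real) powi k > 0" by simp
  have "0 < 2 powi k * (b - a)" using affine by linarith
  then have ab: "a < b" using k by (simp add: zero_less_mult_iff)
  have "g (f t) = e + 2 powi (j + k) * (t - a)" if "t \<in> {a..b}" for t
  proof -
    have "2 powi k * (t - a) \<le> 2 powi k * (b - a)" "0 \<le> 2 powi k * (t - a)"
      using that k by auto
    then have "f t \<in> {c..d}"
      using that affine.prems(1) affine.prems(4)[OF that] unfolding atLeastAtMost_iff by linarith
    then show ?thesis using that affine by (simp add: power_int_add)
  qed
  then show ?case
    using affine ab by (intro dpl.affine[of _ _ _ _ "j + k"]) (auto simp: power_int_add)
next
  case (glue c d e h d' h')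
  \<comment> \<open>The preimage of the outer breakpoint \<open>d\<close> under the affine map
    \<open>f\<close>.\<close>
  let ?x = "a + 2 powi (- k) * (d - c)"
  have k: "(2::real) powi k > 0" by simp
  have x: "2 powi k * (?x - a) = d - c" by (simp add: power_int_minus)
  have "c < d" "d < d'" "dyad c" "dyad d" using glue by (auto dest: dplD)
  then have "0 < 2 powi k * (?x - a)" "2 powi k * (?x - a) < 2 powi k * (b - a)"
    using x glue by linarith+
  then have ax: "a < ?x" "?x < b" using k by (simp_all add: zero_less_mult_iff)
  have "dyad ?x" using glue \<open>dyad c\<close> \<open>dyad d\<close> by (auto intro!: dyad_intros)
  have "dpl (\<lambda>t. g (f t)) a ?x e h"
    using glue.IH(1)[of ?x a] glue.prems x ax \<open>dyad ?x\<close> by auto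
  moreover have "dpl (\<lambda>t. g (f t)) ?x b h h'"
  proof (rule glue.IH(2))
    show "d' - d = 2 powi k * (b - ?x)" using x glue.prems(1) by (simp add: algebra_simps)
    show "f t = d + 2 powi k * (t - ?x)" if "t \<in> {?x..b}" for t
    proof -
      have "f t = c + 2 powi k * (t - a)" using that ax by (intro glue.prems(4)) auto
      then have "f t = c + 2 powi k * (?x - a) + 2 powi k * (t - ?x)"
        by (simp only: algebra_simps)
      then show ?thesis unfolding x by simp
    qed
  qed (use glue.prems \<open>dyad ?x\<close> in auto)
  ultimately show ?case by (rule dpl.glue)
qed

lemma dpl_comp:
  assumes "dpl f a b c d" "dpl g c d e h"
  shows "dpl (\<lambda>t. g (f t)) a b e h"
  using assms
proof (induction arbitrary: e h)
  case (affine a b c d k)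
  then show ?case by (rule_tac dpl_affine_comp[of g c d e h k]) auto
next
  case (glue a b c d b' d')
  then have "c < d" "d < d'" "dyad d" by (auto dest: dplD)
  then have "dpl g c d e (g d) \<and> dpl g d d' (g d) h" using dpl_split[OF glue.prems] by blast
  then show ?case using glue.IH dpl.glue by blast
qed

lemma dpl_inverse:
  assumes "dpl f a b c d" "\<And>t. t \<in> {a..b} \<Longrightarrow> g (f t) = t"
  shows "dpl g c d a b"
  using assms
proof induction
  case (affine a b c d k)
  have dpl: "dpl f a b c d" using affine(1-7) by (rule dpl.affine)
  have "g t = a + 2 powi (- k) * (t - c)" if t: "t \<in> {c..d}" for t
  proof -
    obtain x where x: "x \<in> {a..b}" "f x = t" using dpl_surj[OF dpl t] by blast
    then have "t - c = 2 powi k * (x - a)" "g t = x" using affine by auto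
    then show ?thesis by (simp add: power_int_minus field_simps)
  qed
  moreover have "c < d" using dpl by (rule dplD)
  ultimately show ?case
    using affine by (intro dpl.affine[of _ _ _ _ "- k"]) (auto simp: power_int_minus field_simps)
next
  case (glue a b c d e h)
  then have "a < b" "b < e" by (auto dest: dplD)
  then have "dpl g c d a b" "dpl g d h b e" using glue by auto
  then show ?case by (rule dpl.glue)
qed

lemma dpl_id: "a < b \<Longrightarrow> dyad a \<Longrightarrow> dyad b \<Longrightarrow> (\<And>t. t \<in> {a..b} \<Longrightarrow> f t = t) \<Longrightarrow> dpl f a b a b"
  by (rule dpl.affine[of _ _ _ _ 0]) auto

section \<open>Thompson's group as a group of dyadic piecewise linear maps\<close>

lemma dpl_imp_breakpoints:
  assumes "dpl f a b c d"
  shows "\<exists>B. finite B \<and> {a, b} \<subseteq> B \<and> B \<subseteq> {a..b} \<and> (\<forall>x\<in>B. dyad x \<and> dyad (f x)) \<and>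
     (\<forall>x\<in>B. \<forall>y\<in>B. x < y \<and> {x<..<y} \<inter> B = {} \<longrightarrow>
           (\<exists>k::int. \<forall>t\<in>{x..y}. f t = f x + 2 powi k * (t - x)))"
  using assms
proof induction
  case (affine a b c d k)
  have "dpl f a b c d" using affine by (rule dpl.affine)
  then have ends: "f a = c" "f b = d" by (auto dest: dplD)
  have ex: "\<exists>k::int. \<forall>t\<in>{a..b}. f t = f a + 2 powi k * (t - a)" using affine(7) ends by auto
  have "\<forall>x\<in>{a, b}. \<forall>y\<in>{a, b}. x < y \<and> {x<..<y} \<inter> {a, b} = {} \<longrightarrow>
           (\<exists>k::int. \<forall>t\<in>{x..y}. f t = f x + 2 powi k * (t - x))"
  proof (intro ballI impI)
    fix x y assume "x \<in> {a, b}" "y \<in> {a, b}" "x < y \<and> {x<..<y} \<inter> {a, b} = {}"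
    then have "x = a" "y = b" using affine(1) by auto
    then show "\<exists>k::int. \<forall>t\<in>{x..y}. f t = f x + 2 powi k * (t - x)" using ex by simp
  qed
  moreover have "{a, b} \<subseteq> {a..b}" "\<forall>x\<in>{a, b}. dyad x \<and> dyad (f x)" using affine(1-5) ends by auto
  ultimately show ?case by (intro exI[of _ "{a, b}"] conjI) auto
next
  case (glue a b c d e h)
  from glue.IH(1) obtain B where B: "finite B" "{a, b} \<subseteq> B" "B \<subseteq> {a..b}"
      "\<forall>x\<in>B. dyad x \<and> dyad (f x)"
      "\<forall>x\<in>B. \<forall>y\<in>B. x < y \<and> {x<..<y} \<inter> B = {} \<longrightarrow>
           (\<exists>k::int. \<forall>t\<in>{x..y}. f t = f x + 2 powi k * (t - x))"
    by (elim exE conjE)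
  from glue.IH(2) obtain B' where B': "finite B'" "{b, e} \<subseteq> B'" "B' \<subseteq> {b..e}"
      "\<forall>x\<in>B'. dyad x \<and> dyad (f x)"
      "\<forall>x\<in>B'. \<forall>y\<in>B'. x < y \<and> {x<..<y} \<inter> B' = {} \<longrightarrow>
           (\<exists>k::int. \<forall>t\<in>{x..y}. f t = f x + 2 powi k * (t - x))"
    by (elim exE conjE)
  have "a < b" "b < e" using glue by (auto dest: dplD)
  \<comment> \<open>The point \<open>b\<close> belongs to both sets, so two consecutive points of
    the union never lie on different sides of it.\<close>
  have "\<exists>k::int. \<forall>t\<in>{x..y}. f t = f x + 2 powi k * (t - x)"
    if xy: "x \<in> B \<union> B'" "y \<in> B \<union> B'" "x < y" "{x<..<y} \<inter> (B \<union> B') = {}" for x y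
  proof (cases "y \<le> b")
    case True
    then have "x \<in> B" "y \<in> B" using xy(1-3) B(2) subsetD[OF B'(3)] by force+
    then show ?thesis using bspec[OF bspec[OF B(5)]] xy by blast
  next
    case False
    then have "\<not> x < b" using xy B(2) by force
    then have "x \<in> B'" "y \<in> B'" using xy(1-3) B'(2) subsetD[OF B(3)] False by force+
    then show ?thesis using bspec[OF bspec[OF B'(5)]] xy by blast
  qed
  moreover have "B \<union> B' \<subseteq> {a..e}" using B(3) B'(3) \<open>a < b\<close> \<open>b < e\<close> by force
  moreover have "\<forall>x\<in>B \<union> B'. dyad x \<and> dyad (f x)" using B(4) B'(4) by blast
  moreover have "finite (B \<union> B')" "{a, e} \<subseteq> B \<union> B'" using B(1,2) B'(1,2) by auto
  ultimately show ?case by (intro exI[of _ "B \<union> B'"] conjI) blast+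
qed

lemma dpl_imp_dyadic_PL:
  assumes f: "dpl f 0 1 0 1" shows "dyadic_PL f"
proof -
  have "x \<in> dyadics \<longleftrightarrow> dyad x" "f x \<in> dyadics \<longleftrightarrow> dyad (f x)" if "x \<in> {0..1}" for x
    using that dpl_range[OF f that] by (auto simp: dyad_iff_dyadics)
  then have dy: "(\<forall>x\<in>B. dyad x \<and> dyad (f x)) \<longleftrightarrow> (\<forall>x\<in>B. x \<in> dyadics \<and> f x \<in> dyadics)"
    if "B \<subseteq> {0..1}" for B
    using that by blast
  obtain B where B: "finite B" "{0, 1} \<subseteq> B" "B \<subseteq> {0..1}" "\<forall>x\<in>B. dyad x \<and> dyad (f x)"
    "\<forall>x\<in>B. \<forall>y\<in>B. x < y \<and> {x<..<y} \<inter> B = {} \<longrightarrow>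
           (\<exists>k::int. \<forall>t\<in>{x..y}. f t = f x + 2 powi k * (t - x))"
    using dpl_imp_breakpoints[OF f] by (elim exE conjE)
  show ?thesis
    unfolding dyadic_PL_def using B(1-3,5) B(4)[unfolded dy[OF B(3)]] by (intro exI[of _ B] conjI)
qed

text \<open>Induction on the number of breakpoints below \<open>b\<close>: the piece between
  \<open>b\<close> and its predecessor is glued to the map on the left of that predecessor. The end
  values stay \<open>f 0\<close> and \<open>f 1\<close>, since their determination needs
  monotonicity.\<close>

lemma dyadic_PL_imp_dpl:
  assumes "dyadic_PL f" "\<And>t. t \<in> {0..1} \<Longrightarrow> f t \<in> {0..1}"
  shows "dpl f 0 1 (f 0) (f 1)"
proof -
  obtain B where B: "finite B" "{0, 1} \<subseteq> B" "B \<subseteq> {0..1}" "\<And>b. b\<in>B \<Longrightarrow> b \<in> dyadics \<and> f b \<in> dyadics"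
    and aff: "\<And>a b. a \<in> B \<Longrightarrow> b \<in> B \<Longrightarrow> a < b \<Longrightarrow> {a<..<b} \<inter> B = {} \<Longrightarrow>
           (\<exists>k::int. \<forall>t\<in>{a..b}. f t = f a + 2 powi k * (t - a))"
    using assms(1) unfolding dyadic_PL_def by metis
  have dy: "dyad b \<and> dyad (f b)" if "b \<in> B" for b
    using B(4)[OF that] assms(2)[of b] B(3) that
    by (auto simp: dyad_iff_dyadics subset_iff)
  have "dpl f 0 b (f 0) (f b)" if "b \<in> B" "0 < b" for b
    using that
  proof (induction "card {x \<in> B. x < b}" arbitrary: b rule: less_induct)
    case less
    let ?A = "{x \<in> B. x < b}"
    have A: "finite ?A" "?A \<noteq> {}" using B less.prems by auto
    define a where "a = Max ?A"
    have a: "a \<in> ?A" using Max_in[OF A] by (simp add: a_def)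
    have "{a<..<b} \<inter> B = {}" using Max_ge[OF A(1)] by (fastforce simp: a_def)
    then obtain k :: int where k: "\<forall>t\<in>{a..b}. f t = f a + 2 powi k * (t - a)"
      using aff[of a b] a less.prems by auto
    have "f b - f a = 2 powi k * (b - a)" using bspec[OF k, of b] a by auto
    then have ab: "dpl f a b (f a) (f b)"
      using a less.prems dy bspec[OF k] by (intro dpl.affine[of _ _ _ _ k]) blast+
    show ?case
    proof (cases "a = 0")
      case False
      have "{x \<in> B. x < a} \<subset> ?A" using a by auto
      then have "card {x \<in> B. x < a} < card ?A" using A(1) by (rule psubset_card_mono[rotated])
      moreover have "a \<in> B" "0 < a" using a False B(3) by force+
      ultimately have "dpl f 0 a (f 0) (f a)" by (rule less.hyps)
      then show ?thesis using ab by (rule dpl.glue)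
    qed (use ab in simp)
  qed
  then show ?thesis using B(2) by auto
qed

text \<open>An increasing bijection of the unit interval fixes both endpoints; conversely, a
  continuous bijection on a compact interval is a homeomorphism. So a decomposition into dyadic
  pieces is the whole membership condition.\<close>

lemma carrier_thompson_F: "carrier thompson_F = {f \<in> extensional {0..1}. dpl f 0 1 0 1}"
proof (intro equalityI subsetI)
  fix f assume "f \<in> carrier thompson_F"
  then have f: "f \<in> extensional {0..1}" "bij_betw f {0..1} {0..1}" "strict_mono_on {0..1} f" "dyadic_PL f"
    by (auto simp: thompson_F_def Bij_def)
  have range: "f t \<in> {0..1}" if "t \<in> {0..1}" for t using f(2) that by (auto simp: bij_betw_def)
  have "0 \<in> f ` {0..1}" "1 \<in> f ` {0..1}" using f(2) by (simp_all add: bij_betw_def)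
  then obtain s r where s: "s \<in> {0..1}" "f s = 0" and r: "r \<in> {0..1}" "f r = 1"
    by (elim imageE) auto
  have "s = 0" using strict_mono_onD[OF f(3), of 0 s] s range[of 0] by force
  moreover have "r = 1" using strict_mono_onD[OF f(3), of r 1] r range[of 1] by force
  ultimately show "f \<in> {f \<in> extensional {0..1}. dpl f 0 1 0 1}"
    using dyadic_PL_imp_dpl[OF f(4) range] s r f(1) by auto
next
  fix f assume "f \<in> {f \<in> extensional {0..1}. dpl f 0 1 0 1}"
  then have f: "f \<in> extensional {0..1}" "dpl f 0 1 0 1" by auto
  have bij: "bij_betw f {0..1} {0..1}" using dpl_bij_betw[OF f(2)] .
  then obtain g where "homeomorphism {0..1} {0..1} f g"
    using homeomorphism_compact[of "{0..1}" f "{0..1}"] dpl_continuous_on[OF f(2)]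
    by (auto simp: bij_betw_def)
  then show "f \<in> carrier thompson_F"
    using f bij dpl_strict_mono_on[OF f(2)] dpl_imp_dyadic_PL[OF f(2)]
    by (auto simp: thompson_F_def Bij_def)
qed

lemma thompson_F_in_Bij: "f \<in> carrier thompson_F \<Longrightarrow> f \<in> Bij {0..1}"
  by (simp add: thompson_F_def)

lemma subgroup_thompson_F: "subgroup (carrier thompson_F) (BijGroup {0..1})"
proof (rule subgroup.intro)
  show "carrier thompson_F \<subseteq> carrier (BijGroup {0..1})"
    by (auto simp: BijGroup_def thompson_F_in_Bij)
  show "\<one>\<^bsub>BijGroup {0..1}\<^esub> \<in> carrier thompson_F"
    by (auto simp: BijGroup_def carrier_thompson_F intro!: dpl_id)
  show "f \<otimes>\<^bsub>BijGroup {0..1}\<^esub> g \<in> carrier thompson_F"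
    if "f \<in> carrier thompson_F" "g \<in> carrier thompson_F" for f g
  proof -
    have "dpl (compose {0..1} f g) 0 1 0 1"
      using that dpl_cong[OF dpl_comp[of g 0 1 0 1 f 0 1]]
      by (auto simp: carrier_thompson_F compose_def)
    then show ?thesis
      using that[THEN thompson_F_in_Bij] by (auto simp: BijGroup_def carrier_thompson_F compose_def)
  qed
  show "inv\<^bsub>BijGroup {0..1}\<^esub> f \<in> carrier thompson_F" if f: "f \<in> carrier thompson_F" for f
  proof -
    have d: "dpl f 0 1 0 1" using f by (simp add: carrier_thompson_F)
    have "dpl (\<lambda>x\<in>{0..1}. inv_into {0..1} f x) 0 1 0 1"
    proof (rule dpl_inverse[OF d])
      fix t :: real assume "t \<in> {0..1}"
      then show "(\<lambda>x\<in>{0..1}. inv_into {0..1} f x) (f t) = t"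
        using dpl_bij_betw[OF d] by (auto simp: bij_betw_def)
    qed
    then show ?thesis using thompson_F_in_Bij[OF f] by (simp add: inv_BijGroup carrier_thompson_F)
  qed
qed

section \<open>Pointwise form of the group operations of F\<close>

lemma group_thompson_F: "group thompson_F"
proof -
  have "thompson_F = (BijGroup {0..1})\<lparr>carrier := carrier thompson_F\<rparr>"
    by (simp add: thompson_F_def)
  then show ?thesis
    using subgroup.subgroup_is_group[OF subgroup_thompson_F group_BijGroup] by simp
qed

interpretation TF: group thompson_F
  by (rule group_thompson_F)

lemma thompson_F_mult_apply:
  assumes "f \<in> carrier thompson_F" "g \<in> carrier thompson_F" "t \<in> {0..1}"
  shows "(f \<otimes>\<^bsub>thompson_F\<^esub> g) t = f (g t)"
proof -
  have "f \<in> Bij {0..1}" "g \<in> Bij {0..1}" using assms by (auto intro: thompson_F_in_Bij)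
  then show ?thesis using assms(3) by (simp add: thompson_F_def BijGroup_def compose_def)
qed

lemma thompson_F_one_apply: "t \<in> {0..1} \<Longrightarrow> \<one>\<^bsub>thompson_F\<^esub> t = t"
  by (simp add: thompson_F_def BijGroup_def)

lemma thompson_F_range: "f \<in> carrier thompson_F \<Longrightarrow> t \<in> {0..1} \<Longrightarrow> f t \<in> {0..1}"
  using dpl_range[of f 0 1 0 1 t] by (simp add: carrier_thompson_F)

lemma thompson_F_inv_apply:
  assumes f: "f \<in> carrier thompson_F" and t: "t \<in> {0..1}"
  shows "(inv\<^bsub>thompson_F\<^esub> f) (f t) = t" "f ((inv\<^bsub>thompson_F\<^esub> f) t) = t"
proof -
  have "(inv\<^bsub>thompson_F\<^esub> f \<otimes>\<^bsub>thompson_F\<^esub> f) t = t" "(f \<otimes>\<^bsub>thompson_F\<^esub> inv\<^bsub>thompson_F\<^esub> f) t = t"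
    using f t by (simp_all add: thompson_F_one_apply)
  then show "(inv\<^bsub>thompson_F\<^esub> f) (f t) = t" "f ((inv\<^bsub>thompson_F\<^esub> f) t) = t"
    by (simp_all only: thompson_F_mult_apply f t TF.inv_closed)
qed

lemma thompson_F_eqI:
  assumes "f \<in> carrier thompson_F" "g \<in> carrier thompson_F" "\<And>t. t \<in> {0..1} \<Longrightarrow> f t = g t"
  shows "f = g"
proof (rule extensionalityI)
  show "f \<in> extensional {0..1}" "g \<in> extensional {0..1}"
    using assms(1,2) by (simp_all add: carrier_thompson_F)
qed (rule assms(3))

section \<open>Generation by \<open>x\<^sub>0\<close> and \<open>x\<^sub>1\<close>\<close>

text \<open>The pieces of x_0, rescaled by h, meet at 1 - h/2 and 1 - h/4. The last formula is free
  of h because that piece has slope 2 and fixes 1.\<close>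

lemma thompson_x_eq:
  assumes h: "h = 1 / 2 ^ n" and t: "t \<in> {0..1}"
  shows "thompson_x n t =
    (if t \<le> 1 - h then t else if t \<le> 1 - h / 2 then (t + 1 - h) / 2
     else if t \<le> 1 - h / 4 then t - h / 4 else 2 * t - 1)"
proof (cases "t \<le> 1 - h")
  case False
  have h0: "h > 0" and h2: "2 ^ n = 1 / h" using h by auto
  define s where "s = (t - 1 + h) / h"
  have hs: "h * s = t - 1 + h" using h0 by (simp add: s_def)
  have s: "s \<in> {0..1}" using False t h0 by (auto simp: s_def field_simps)
  have "thompson_x n t = 1 - h + h * thompson_x0 s"
    using False t unfolding thompson_x_def h2 s_def by simp
  moreover have "s \<le> 1 / 2 \<longleftrightarrow> t \<le> 1 - h / 2" "s \<le> 3 / 4 \<longleftrightarrow> t \<le> 1 - h / 4"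
    using h0 by (auto simp: s_def field_simps)
  moreover have "h * (s / 2) = (t - 1 + h) / 2" "h * (s - 1 / 4) = t - 1 + h - h / 4"
    "h * (2 * s - 1) = 2 * (t - 1 + h) - h"
    using hs by (simp_all add: algebra_simps)
  moreover have "h * thompson_x0 s =
      (if s \<le> 1 / 2 then h * (s / 2) else if s \<le> 3 / 4 then h * (s - 1 / 4) else h * (2 * s - 1))"
    using s by (simp add: thompson_x0_def)
  ultimately have "thompson_x n t = 1 - h + (if t \<le> 1 - h / 2 then (t - 1 + h) / 2
      else if t \<le> 1 - h / 4 then t - 1 + h - h / 4 else 2 * (t - 1 + h) - h)"
    by (simp only:)
  then show ?thesis using False by (auto split: if_splits; simp add: field_simps)
qed (use t in \<open>auto simp: thompson_x_def h\<close>)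

lemma thompson_x_0: "thompson_x 0 = thompson_x0"
  by (rule ext) (auto simp: thompson_x_def thompson_x0_def restrict_def)

text \<open>Division points of the partition obtained by halving only the rightmost interval, again
  and again: the right vine in the language of binary trees. The intervals between the first N + 1
  of these points, followed by \<open>[vine N, 1]\<close>, form the reference partition with N + 1
  intervals.\<close>

definition vine :: "nat \<Rightarrow> real" where
  "vine n = 1 - 1 / 2 ^ n"

lemma vine_0 [simp]: "vine 0 = 0"
  by (simp add: vine_def)

lemma vine_Suc: "vine (Suc n) = (vine n + 1) / 2"
  by (simp add: vine_def field_simps)

lemma vine_lt_1: "vine n < 1"
  by (simp add: vine_def)

lemma vine_nonneg: "0 \<le> vine n"
  by (simp add: vine_def)

lemma vine_less_Suc: "vine n < vine (Suc n)"
  using vine_lt_1[of n] by (simp add: vine_Suc)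

lemma vine_mono: "i \<le> j \<Longrightarrow> vine i \<le> vine j"
  using lift_Suc_mono_le[of vine i j] vine_less_Suc by (simp add: less_imp_le)

lemma dyad_vine: "dyad (vine n)"
  unfolding vine_def using dyad_div_power2[of 1 n] by (auto intro!: dyad_intros)

text \<open>In terms of vine intervals: x_n sends interval n onto its own left half, interval n + 1
  onto the right half of interval n, and every later interval onto its predecessor.\<close>

lemma thompson_x_vine:
  assumes "t \<in> {0..1}"
  shows "t \<le> vine n \<Longrightarrow> thompson_x n t = t"
    "t \<in> {vine n..vine (Suc n)} \<Longrightarrow> thompson_x n t = vine n + 1/2 * (t - vine n)"
    "t \<in> {vine (Suc n)..vine (Suc (Suc n))} \<Longrightarrow>
       thompson_x n t = (vine n + vine (Suc n)) / 2 + (t - vine (Suc n))"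
    "vine (Suc (Suc n)) \<le> t \<Longrightarrow> thompson_x n t = 2 * t - 1"
proof -
  define h :: real where "h = 1 / 2 ^ n"
  have h: "h > 0" by (simp add: h_def)
  have v: "vine n = 1 - h" "vine (Suc n) = 1 - h / 2" "vine (Suc (Suc n)) = 1 - h / 4"
    by (simp_all add: vine_def h_def)
  show "t \<le> vine n \<Longrightarrow> thompson_x n t = t"
    "t \<in> {vine n..vine (Suc n)} \<Longrightarrow> thompson_x n t = vine n + 1/2 * (t - vine n)"
    "t \<in> {vine (Suc n)..vine (Suc (Suc n))} \<Longrightarrow>
       thompson_x n t = (vine n + vine (Suc n)) / 2 + (t - vine (Suc n))"
    "vine (Suc (Suc n)) \<le> t \<Longrightarrow> thompson_x n t = 2 * t - 1"
    unfolding v thompson_x_eq[OF h_def assms] using h by (auto simp: field_simps)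
qed

lemma thompson_x_in_F: "thompson_x n \<in> carrier thompson_F"
proof -
  let ?x = "thompson_x n" and ?v = "vine n" and ?w = "vine (Suc n)" and ?z = "vine (Suc (Suc n))"
  have d: "dyad ?v" "dyad ?w" "dyad ?z" by (auto intro: dyad_vine)
  have "dyad ((?v + ?w) * 2 powi (-1))" using d by (intro dyad_intros)
  then have m: "dyad ((?v + ?w) / 2)" by simp
  have v: "0 \<le> ?v" "?v < ?w" "?w < ?z" "?z < 1" using vine_nonneg vine_less_Suc vine_lt_1 by auto
  have "dpl ?x ?v ?w ?v ((?v + ?w) / 2)"
    using v d m thompson_x_vine(2)[of _ n]
    by (intro dpl.affine[of _ _ _ _ "-1"]) (auto simp: field_simps)
  moreover have "dpl ?x ?w ?z ((?v + ?w) / 2) ?w"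
    using v d m thompson_x_vine(3)[of _ n]
    by (intro dpl.affine[of _ _ _ _ "0"]) (auto simp: vine_Suc field_simps)
  moreover have "dpl ?x ?z 1 ?w 1"
  proof (rule dpl.affine[of _ _ _ _ "1"])
    show "?x t = ?w + 2 powi 1 * (t - ?z)" if "t \<in> {?z..1}" for t
      using thompson_x_vine(4)[of t n] that v by (simp add: vine_Suc field_simps)
  qed (use v d in \<open>auto simp: vine_Suc field_simps\<close>)
  ultimately have v1: "dpl ?x ?v 1 ?v 1" by (meson dpl.glue)
  have "dpl ?x 0 1 0 1"
  proof (cases "?v = 0")
    case False
    then have "dpl ?x 0 ?v 0 ?v" using v d thompson_x_vine(1)[of _ n] by (intro dpl_id) auto
    then show ?thesis using v1 by (rule dpl.glue)
  qed (use v1 in simp)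
  then show ?thesis by (auto simp: carrier_thompson_F thompson_x_def)
qed

lemma thompson_x0_in_F: "thompson_x0 \<in> carrier thompson_F"
  using thompson_x_in_F[of 0] by (simp add: thompson_x_0)

definition x01_group :: "(real \<Rightarrow> real) set" where
  "x01_group = generate thompson_F {thompson_x0, thompson_x 1}"

lemma subgroup_x01_group: "subgroup x01_group thompson_F"
  unfolding x01_group_def by (rule TF.generate_is_subgroup) (simp add: thompson_x_in_F thompson_x0_in_F)

text \<open>The relation that expresses x_(n+1) as a conjugate of x_n by x_0. For n at least 1 the
  support of x_(n+1) lies in \<open>[3/4, 1]\<close>, where x_0 is 2t - 1 and doubles distances from
  1; left of 1 - h/2 both sides are x_0.\<close>

lemma thompson_x0_thompson_x_Suc:
  assumes "n \<ge> 1"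
  shows "thompson_x0 \<otimes>\<^bsub>thompson_F\<^esub> thompson_x (Suc n) = thompson_x n \<otimes>\<^bsub>thompson_F\<^esub> thompson_x0"
proof (rule thompson_F_eqI)
  fix t :: real assume t: "t \<in> {0..1}"
  define h :: real where "h = 1 / 2 ^ n"
  have "(2::real) ^ 1 \<le> 2 ^ n" using assms by (intro power_increasing) auto
  then have h: "0 < h" "h \<le> 1 / 2" by (auto simp: h_def field_simps)
  have "h / 2 = 1 / 2 ^ Suc n" by (simp add: h_def)
  then have x_Suc: "thompson_x (Suc n) t =
    (if t \<le> 1 - h / 2 then t else if t \<le> 1 - h / 4 then (t + 1 - h / 2) / 2
     else if t \<le> 1 - h / 8 then t - h / 8 else 2 * t - 1)"
    using thompson_x_eq[of "h / 2" "Suc n" t] t by simp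
  have x0: "thompson_x0 s = (if s \<le> 1/2 then s / 2 else if s \<le> 3/4 then s - 1/4 else 2 * s - 1)"
    if "s \<in> {0..1}" for s :: real
    using that by (simp add: thompson_x0_def)
  have ranges: "thompson_x (Suc n) t \<in> {0..1}" "thompson_x0 t \<in> {0..1}"
    using t thompson_F_range thompson_x_in_F thompson_x0_in_F by blast+
  define y z where "y = thompson_x (Suc n) t" and "z = thompson_x0 t"
  have "thompson_x0 y = thompson_x n z"
    unfolding x0[OF ranges(1)[folded y_def]] thompson_x_eq[OF h_def ranges(2)[folded z_def]]
    using h t x_Suc[folded y_def] x0[OF t, folded z_def] by (auto split: if_splits; simp add: field_simps)
  then show "(thompson_x0 \<otimes>\<^bsub>thompson_F\<^esub> thompson_x (Suc n)) t =
      (thompson_x n \<otimes>\<^bsub>thompson_F\<^esub> thompson_x0) t"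
    using t by (simp add: thompson_F_mult_apply thompson_x_in_F thompson_x0_in_F y_def z_def)
qed (auto simp: thompson_x_in_F thompson_x0_in_F)

lemma thompson_x_in_x01_group: "thompson_x n \<in> x01_group"
proof -
  interpret H: subgroup x01_group thompson_F by (rule subgroup_x01_group)
  have x0: "thompson_x0 \<in> x01_group" and x1: "thompson_x 1 \<in> x01_group"
    by (auto simp: x01_group_def intro: generate.incl)
  have "thompson_x (Suc n) \<in> x01_group" for n
  proof (induction n)
    case (Suc n)
    have "thompson_x (Suc (Suc n)) =
        inv\<^bsub>thompson_F\<^esub> thompson_x0 \<otimes>\<^bsub>thompson_F\<^esub> (thompson_x (Suc n) \<otimes>\<^bsub>thompson_F\<^esub> thompson_x0)"
      using thompson_x0_thompson_x_Suc[of "Suc n"] thompson_x_in_F thompson_x0_in_F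
      by (intro TF.inv_solve_left[THEN iffD2]) auto
    then show ?case using Suc x0 by auto
  qed (use x1 in simp)
  then show ?thesis using x0 by (cases n) (auto simp: thompson_x_0)
qed

text \<open>The slope is read off from the endpoints and need not be a power of 2, so composing and
  halving pieces requires no bookkeeping of exponents.\<close>

definition aff :: "(real \<Rightarrow> real) \<Rightarrow> real \<Rightarrow> real \<Rightarrow> real \<Rightarrow> real \<Rightarrow> bool" where
  "aff f a b c d \<longleftrightarrow> (\<forall>t\<in>{a..b}. f t = c + (d - c) / (b - a) * (t - a))"

lemma affI:
  assumes "a < b" "d - c = k * (b - a)" "\<And>t. t \<in> {a..b} \<Longrightarrow> f t = c + k * (t - a)"
  shows "aff f a b c d"
proof -
  have "(d - c) / (b - a) = k" using assms(1,2) by simp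
  then show ?thesis using assms(3) by (simp add: aff_def)
qed

lemma aff_comp:
  assumes "aff f a b c d" "aff g c d e h" "a < b" "c < d"
  shows "aff (\<lambda>t. g (f t)) a b e h"
  unfolding aff_def
proof
  fix t assume t: "t \<in> {a..b}"
  have ft: "f t = c + (d - c) / (b - a) * (t - a)" using t assms by (auto simp: aff_def)
  have "0 \<le> (t - a) / (b - a)" "(t - a) / (b - a) \<le> 1" using t assms by auto
  then have "(d - c) * ((t - a) / (b - a)) \<le> (d - c) * 1" "0 \<le> (d - c) * ((t - a) / (b - a))"
    using assms by (intro mult_left_mono mult_nonneg_nonneg; simp)+
  then have "f t \<in> {c..d}" using ft by auto
  then have "g (f t) = e + (h - e) / (d - c) * (f t - c)" using assms by (auto simp: aff_def)
  then show "g (f t) = e + (h - e) / (b - a) * (t - a)" using ft assms by simp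
qed

lemma aff_halves:
  assumes "aff f a b c d" "a < b"
  shows "aff f a ((a + b) / 2) c ((c + d) / 2)" "aff f ((a + b) / 2) b ((c + d) / 2) d"
proof -
  define k where "k = (d - c) / (b - a)"
  have k: "k * (b - a) = d - c" using assms(2) by (simp add: k_def)
  have f: "f t = c + k * (t - a)" if "t \<in> {a..b}" for t
    using assms(1) that by (simp add: aff_def k_def)
  have "((c + d) / 2 - c) / ((a + b) / 2 - a) = k" "(d - (c + d) / 2) / (b - (a + b) / 2) = k"
    using assms(2) k by (simp_all add: field_simps)
  moreover have "c + k * (t - a) = (c + d) / 2 + k * (t - (a + b) / 2)" for t
    using k by (simp add: field_simps)
  ultimately show "aff f a ((a + b) / 2) c ((c + d) / 2)" "aff f ((a + b) / 2) b ((c + d) / 2) d"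
    using f assms(2) unfolding aff_def by simp_all
qed

section \<open>Partitions into standard dyadic intervals\<close>

definition std_interval :: "real \<Rightarrow> real \<Rightarrow> bool" where
  "std_interval c d \<longleftrightarrow> (\<exists>(p::int) (n::nat). c = of_int p / 2 ^ n \<and> d = of_int (p + 1) / 2 ^ n)"

lemma std_interval_less: "std_interval c d \<Longrightarrow> c < d"
  by (auto simp: std_interval_def divide_strict_right_mono)

text \<open>An odd numerator means lowest terms, and a representation whose denominator is no larger
  has to be the same one.\<close>

lemma dyadic_level_eq:
  fixes p q :: int
  assumes "of_int p / 2 ^ n = (of_int q / 2 ^ k :: real)" "k \<le> n" "odd p"
  shows "k = n \<and> q = p"
proof -
  have "(of_int p :: real) = of_int q * 2 ^ (n - k)"
    using assms(1,2) by (simp add: field_simps power_diff)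
  then have p: "p = q * 2 ^ (n - k)"
    by (metis of_int_eq_iff of_int_mult of_int_numeral of_int_power)
  then have "n - k = 0" using assms(3) by (cases "n - k") auto
  then show ?thesis using p assms(2) by simp
qed

text \<open>
  The finest interval of a partition has a sibling in it, since neighbours that are at least
  as long start and end at points of lower level.
\<close>

lemma ex_siblings:
  fixes c :: "nat \<Rightarrow> real"
  assumes "c 0 = 0" "c (Suc (Suc N)) = 1" "\<And>i. i \<le> Suc N \<Longrightarrow> std_interval (c i) (c (Suc i))"
  shows "\<exists>j\<le>N. std_interval (c j) (c (Suc (Suc j))) \<and> c (Suc j) = (c j + c (Suc (Suc j))) / 2"
proof -
  have "\<forall>i\<in>{..Suc N}. \<exists>(p::int) (n::nat). c i = of_int p / 2 ^ n \<and> c (Suc i) = of_int (p + 1) / 2 ^ n"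
    using assms(3) by (auto simp: std_interval_def)
  then obtain p :: "nat \<Rightarrow> int" and n :: "nat \<Rightarrow> nat" where
    pn: "\<And>i. i \<le> Suc N \<Longrightarrow> c i = of_int (p i) / 2 ^ n i \<and> c (Suc i) = of_int (p i + 1) / 2 ^ n i"
    unfolding bchoice_iff by (metis atMost_iff)
  have "Max (n ` {..Suc N}) \<in> n ` {..Suc N}" by (intro Max_in) auto
  then obtain i where i: "i \<le> Suc N" and "n i = Max (n ` {..Suc N})"
    by (metis atMost_iff imageE)
  then have max: "n k \<le> n i" if "k \<le> Suc N" for k using that by simp
  have mono: "c j < c k" if "j < k" "k \<le> Suc (Suc N)" for j k
    using that
  proof (induction k)
    case (Suc k)
    then have "c k < c (Suc k)" using assms(3) std_interval_less by simp
    then show ?case using Suc by (cases "j = k") auto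
  qed simp
  \<comment> \<open>A finest interval of level 0 would be all of \<open>[0, 1]\<close>, but the
    partition has at least two intervals.\<close>
  have "n i \<noteq> 0"
  proof
    assume 0: "n i = 0"
    have "0 \<le> c i" using mono[of 0 i] i assms(1) by (cases "i = 0") auto
    moreover have "c (Suc i) \<le> 1"
      using mono[of "Suc i" "Suc (Suc N)"] i assms(2) by (cases "i = Suc N") auto
    ultimately have "c i = 0" "c (Suc i) = 1" using pn[OF i] 0 by auto
    then have "i = 0" "Suc i = Suc (Suc N)"
      using mono[of 0 i] mono[of "Suc i" "Suc (Suc N)"] i assms(1,2) by force+
    then show False by simp
  qed
  then obtain m where m: "n i = Suc m" using not0_implies_Suc by blast
  have "\<exists>j\<le>N. \<exists>r::int. c j = of_int (2 * r) / 2 ^ Suc m \<and> c (Suc j) = of_int (2 * r + 1) / 2 ^ Suc m \<and>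
      c (Suc (Suc j)) = of_int (2 * r + 2) / 2 ^ Suc m"
  \<comment> \<open>An even numerator marks a left child, whose sibling is the next interval; an odd
    one marks a right child, whose sibling is the previous interval. Either way the shared endpoint
    has an odd numerator at the maximal level.\<close>
  proof (cases "even (p i)")
    case True
    then have odd: "odd (p i + 1)" by simp
    have "i \<noteq> Suc N"
    proof
      assume "i = Suc N"
      have "of_int (p i + 1) / 2 ^ n i = c (Suc i)" using pn[OF i] by (simp only:)
      also have "\<dots> = of_int 1 / 2 ^ 0" using \<open>i = Suc N\<close> assms(2) by simp
      finally have "of_int (p i + 1) / 2 ^ n i = (of_int 1 / 2 ^ 0 :: real)" .
      from dyadic_level_eq[OF this _ odd] show False using \<open>n i \<noteq> 0\<close> by simp
    qed
    then have iN: "i \<le> N" using i by simp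
    have "of_int (p i + 1) / 2 ^ n i = (of_int (p (Suc i)) / 2 ^ n (Suc i) :: real)"
      using pn[OF i] pn[of "Suc i"] iN by simp
    from dyadic_level_eq[OF this max odd]
    have "n (Suc i) = Suc m" "p (Suc i) = p i + 1" using iN m by auto
    then show ?thesis
      using pn[OF i] pn[of "Suc i"] iN m True by (auto elim!: evenE intro!: exI[of _ i])
  next
    case False
    have "i \<noteq> 0"
      using pn[OF i] assms(1) False by (intro notI) auto
    then obtain j where j: "i = Suc j" using not0_implies_Suc by blast
    have "of_int (p i) / 2 ^ n i = (of_int (p j + 1) / 2 ^ n j :: real)"
      using pn[OF i] pn[of j] i j by simp
    from dyadic_level_eq[OF this max False]
    have "n j = Suc m" "p j + 1 = p i" using i j m by auto
    then show ?thesis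
      using pn[OF i] pn[of j] i j m False
      by (auto elim!: oddE intro!: exI[of _ j])
  qed
  then obtain j and r :: int where "j \<le> N" and c: "c j = of_int (2 * r) / 2 ^ Suc m"
    "c (Suc j) = of_int (2 * r + 1) / 2 ^ Suc m" "c (Suc (Suc j)) = of_int (2 * r + 2) / 2 ^ Suc m"
    by blast
  moreover have "c j = of_int r / 2 ^ m \<and> c (Suc (Suc j)) = of_int (r + 1) / 2 ^ m"
    using c by (simp add: field_simps)
  then have "std_interval (c j) (c (Suc (Suc j)))" unfolding std_interval_def by blast
  moreover have "c (Suc j) = (c j + c (Suc (Suc j))) / 2"
    unfolding c by (simp add: add_divide_distrib)
  ultimately show ?thesis by blast
qed

text \<open>Two siblings are merged into one interval, induction supplies \<open>g\<close> for the
  coarser partition, and the cut is restored on the source side by multiplying with x_j on the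
  right.\<close>

lemma ex_partition_map:
  fixes c :: "nat \<Rightarrow> real"
  assumes "c 0 = 0" "c (Suc N) = 1" "\<And>i. i \<le> N \<Longrightarrow> std_interval (c i) (c (Suc i))"
  shows "\<exists>g\<in>x01_group. (\<forall>i<N. aff g (vine i) (vine (Suc i)) (c i) (c (Suc i))) \<and> aff g (vine N) 1 (c N) 1"
  using assms
proof (induction N arbitrary: c)
  case 0
  have "\<one>\<^bsub>thompson_F\<^esub> \<in> x01_group" unfolding x01_group_def by (rule generate.one)
  moreover have "aff \<one>\<^bsub>thompson_F\<^esub> 0 1 0 1" by (auto simp: aff_def thompson_F_one_apply)
  ultimately show ?case using 0 by auto
next
  case (Suc N)
  interpret H: subgroup x01_group thompson_F by (rule subgroup_x01_group)
  obtain j where j: "j \<le> N" "std_interval (c j) (c (Suc (Suc j)))"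
    and half: "c (Suc j) = (c j + c (Suc (Suc j))) / 2"
    using ex_siblings[OF Suc.prems] by blast
  define c' where "c' i = (if i \<le> j then c i else c (Suc i))" for i
  have "std_interval (c' i) (c' (Suc i))" if "i \<le> N" for i
    using Suc.prems(3)[of i] Suc.prems(3)[of "Suc i"] j that
    by (cases "i < j"; cases "i = j") (auto simp: c'_def)
  then obtain g where g: "g \<in> x01_group"
    "\<And>i. i < N \<Longrightarrow> aff g (vine i) (vine (Suc i)) (c' i) (c' (Suc i))" "aff g (vine N) 1 (c' N) 1"
    using Suc.IH[of c'] Suc.prems(1,2) j(1) by (auto simp: c'_def)
  show ?case
  proof (cases "j = N")
    case True
    \<comment> \<open>The step from N to N + 1 halves the last interval of the reference partition
      anyway, so \<open>g\<close> can be kept.\<close>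
    have "aff g (vine N) 1 (c N) 1" using g(3) True by (simp add: c'_def)
    from aff_halves(1)[OF this vine_lt_1] aff_halves(2)[OF this vine_lt_1]
    have "aff g (vine N) (vine (Suc N)) (c N) (c (Suc N))" "aff g (vine (Suc N)) 1 (c (Suc N)) 1"
      by (simp_all only: vine_Suc half[unfolded True Suc.prems(2)])
    moreover have "aff g (vine i) (vine (Suc i)) (c i) (c (Suc i))" if "i < N" for i
      using g(2)[OF that] that True by (simp add: c'_def)
    ultimately show ?thesis using g(1) by (auto simp: less_Suc_eq)
  next
    case False
    then have jN: "j < N" using j by simp
    let ?g = "g \<otimes>\<^bsub>thompson_F\<^esub> thompson_x j" and ?x = "thompson_x j"
    let ?m = "(vine j + vine (Suc j)) / 2"
    have carr: "g \<in> carrier thompson_F" "?x \<in> carrier thompson_F"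
      using g(1) by (auto intro: thompson_x_in_F)
    have comp: "aff ?g a b e h"
      if "aff ?x a b a' b'" "aff g a' b' e h" "a < b" "a' < b'" "0 \<le> a" "b \<le> 1" for a b a' b' e h
      using aff_comp[OF that(1-4)] that(5,6) carr by (auto simp: aff_def thompson_F_mult_apply)
    have v: "0 \<le> vine i" "vine i < vine (Suc i)" "vine i < 1" for i
      using vine_nonneg vine_less_Suc vine_lt_1 by auto
    have low: "aff ?x (vine i) (vine (Suc i)) (vine i) (vine (Suc i))" if "i < j" for i
    proof -
      have "vine (Suc i) \<le> vine j" using that by (intro vine_mono) simp
      then show ?thesis
        using thompson_x_vine(1)[of _ j] v[of i] v[of "Suc i"] by (auto simp: aff_def)
    qed
    have mid1: "aff ?x (vine j) (vine (Suc j)) (vine j) ?m"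
    proof (rule affI[where k = "1 / 2"])
      show "?x t = vine j + 1 / 2 * (t - vine j)" if "t \<in> {vine j..vine (Suc j)}" for t
        using thompson_x_vine(2)[of t j] that v[of j] v[of "Suc j"] by auto
    qed (use v[of j] in \<open>simp_all add: field_simps\<close>)
    have mid2: "aff ?x (vine (Suc j)) (vine (Suc (Suc j))) ?m (vine (Suc j))"
    proof (rule affI[where k = 1])
      show "?x t = ?m + 1 * (t - vine (Suc j))" if "t \<in> {vine (Suc j)..vine (Suc (Suc j))}" for t
        using thompson_x_vine(3)[of t j] that v[of "Suc j"] v[of "Suc (Suc j)"] by auto
    qed (use v[of "Suc j"] in \<open>simp_all add: vine_Suc field_simps\<close>)
    have high: "aff ?x (vine (Suc i)) y (vine i) z"
      if "j < i" "vine (Suc i) < y" "z = 2 * y - 1" "y \<le> 1" for i y z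
    proof -
      have "vine (Suc (Suc j)) \<le> vine (Suc i)" using that by (intro vine_mono) simp
      moreover have "z - vine i = 2 * (y - vine (Suc i))" using that by (simp add: vine_Suc field_simps)
      moreover have "vine i = 2 * vine (Suc i) - 1" by (simp add: vine_Suc field_simps)
      ultimately show ?thesis
        using thompson_x_vine(4)[of _ j] v[of "Suc i"] that vine_Suc[of "Suc j"]
        by (intro affI[where k = 2]) auto
    qed
    have gj: "aff g (vine j) (vine (Suc j)) (c j) (c (Suc (Suc j)))"
      using g(2)[OF jN] by (simp add: c'_def)
    have "aff ?g (vine i) (vine (Suc i)) (c i) (c (Suc i))" if "i < Suc N" for i
    proof -
      consider "i < j" | "i = j" | "i = Suc j" | k where "i = Suc k" "j < k"
        by (metis Suc_lessI lessE linorder_neqE_nat)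
      then show ?thesis
      proof cases
        case 1
        then show ?thesis using g(2)[of i] jN v by (intro comp[OF low]) (auto simp: c'_def less_imp_le)
      next
        case 2
        show ?thesis
          unfolding 2 using aff_halves(1)[OF gj, folded half] v[of j] v[of "Suc j"] by (intro comp[OF mid1]) auto
      next
        case 3
        show ?thesis
          unfolding 3 using aff_halves(2)[OF gj, folded half] v[of j] v[of "Suc j"] v[of "Suc (Suc j)"]
          by (intro comp[OF mid2]) auto
      next
        case 4
        then have x: "aff ?x (vine i) (vine (Suc i)) (vine k) (vine (Suc k))"
          unfolding 4 using v by (intro high) (auto simp: vine_Suc less_imp_le)
        show ?thesis
          using g(2)[of k] 4 that v[of i] v[of "Suc i"] v[of k] by (intro comp[OF x]) (auto simp: c'_def)
      qed
    qed
    moreover have "aff ?g (vine (Suc N)) 1 (c (Suc N)) 1"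
      using comp[OF high[OF jN, of 1 1]] g(3) v jN by (auto simp: c'_def)
    moreover have "?g \<in> x01_group" using g(1) thompson_x_in_x01_group by auto
    ultimately show ?thesis by blast
  qed
qed

text \<open>A piece of slope 2^k pulls the grid of mesh 2^(-M) in the range back to the grid of mesh
  2^(-M-k) in the domain, once these grids contain the left ends \<open>c\<close> and
  \<open>a\<close> of the piece. A fine uniform partition of the range thus has a standard
  preimage.\<close>

lemma dpl_std_preimage:
  assumes "dpl f a b c d"
  shows "\<exists>M0. \<forall>M\<ge>M0. \<forall>q::int. c \<le> of_int q / 2 ^ M \<and> of_int (q + 1) / 2 ^ M \<le> d \<longrightarrow>
     (\<exists>x y. a \<le> x \<and> y \<le> b \<and> std_interval x y \<and> aff f x y (of_int q / 2 ^ M) (of_int (q + 1) / 2 ^ M))"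
  using assms
proof induction
  case (affine a b c d k)
  obtain na where na: "\<And>k. k \<ge> na \<Longrightarrow> \<exists>p::int. a = of_int p / 2 ^ k" using dyadE[OF affine(2)] by blast
  obtain nc where nc: "\<And>k. k \<ge> nc \<Longrightarrow> \<exists>p::int. c = of_int p / 2 ^ k" using dyadE[OF affine(4)] by blast
  show ?case
  \<comment> \<open>For such \<open>M\<close> the source level M + k is a natural number and at
    least \<open>na\<close>, and \<open>M\<close> is at least \<open>nc\<close>.\<close>
  proof (intro exI[of _ "na + nc + nat (- k)"] allI impI)
    fix M and q :: int
    assume M: "na + nc + nat (- k) \<le> M" and q: "c \<le> of_int q / 2 ^ M \<and> of_int (q + 1) / 2 ^ M \<le> d"
    define n where "n = nat (int M + k)"
    have n: "int n = int M + k" "na \<le> n" "nc \<le> M" using M unfolding n_def by linarith+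
    have "(2::real) ^ n = 2 powi (int n)" by simp
    also have "\<dots> = 2 ^ M * 2 powi k" unfolding n by (simp add: power_int_add)
    finally have pow: "(2::real) ^ n = 2 ^ M * 2 powi k" .
    obtain s r :: int where s: "a = of_int s / 2 ^ n" and r: "c = of_int r / 2 ^ M"
      using na[OF n(2)] nc[OF n(3)] by blast
    let ?x = "of_int (s + q - r) / 2 ^ n :: real" and ?y = "of_int (s + q - r + 1) / 2 ^ n :: real"
    have k: "(2::real) powi k > 0" by simp
    have x: "2 powi k * (?x - a) = of_int q / 2 ^ M - c" and y: "2 powi k * (?y - a) = of_int (q + 1) / 2 ^ M - c"
      unfolding s r pow by (simp_all add: field_simps)
    have "0 \<le> 2 powi k * (?x - a)" "2 powi k * (?y - a) \<le> 2 powi k * (b - a)"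
      using x y q affine(6) by linarith+
    then have xy: "a \<le> ?x" "?y \<le> b" using k by (simp_all add: zero_le_mult_iff)
    have std: "std_interval ?x ?y" unfolding std_interval_def by blast
    have "aff f ?x ?y (of_int q / 2 ^ M) (of_int (q + 1) / 2 ^ M)"
      unfolding aff_def
    proof
      fix t assume t: "t \<in> {?x..?y}"
      have "f t = c + 2 powi k * (?x - a) + 2 powi k * (t - ?x)"
        using affine(7)[of t] t xy by (simp add: right_diff_distrib)
      moreover have "(of_int (q + 1) / 2 ^ M - of_int q / 2 ^ M) / (?y - ?x) = 2 powi k"
        unfolding pow by (simp add: field_simps)
      ultimately show "f t = of_int q / 2 ^ M
          + (of_int (q + 1) / 2 ^ M - of_int q / 2 ^ M) / (?y - ?x) * (t - ?x)"
        using x by simp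
    qed
    then show "\<exists>x y. a \<le> x \<and> y \<le> b \<and> std_interval x y \<and>
        aff f x y (of_int q / 2 ^ M) (of_int (q + 1) / 2 ^ M)"
      using xy std by blast
  qed
next
  case (glue a b c d e h)
  have ab: "a < b" "b < e" "dyad d" using glue by (auto dest: dplD)
  obtain nd where nd: "\<And>k. k \<ge> nd \<Longrightarrow> \<exists>p::int. d = of_int p / 2 ^ k" using dyadE[OF ab(3)] by blast
  obtain M1 M2 where
    M1: "\<forall>M\<ge>M1. \<forall>q::int. c \<le> of_int q / 2 ^ M \<and> of_int (q + 1) / 2 ^ M \<le> d \<longrightarrow>
     (\<exists>x y. a \<le> x \<and> y \<le> b \<and> std_interval x y \<and> aff f x y (of_int q / 2 ^ M) (of_int (q + 1) / 2 ^ M))"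
    and M2: "\<forall>M\<ge>M2. \<forall>q::int. d \<le> of_int q / 2 ^ M \<and> of_int (q + 1) / 2 ^ M \<le> h \<longrightarrow>
     (\<exists>x y. b \<le> x \<and> y \<le> e \<and> std_interval x y \<and> aff f x y (of_int q / 2 ^ M) (of_int (q + 1) / 2 ^ M))"
    using glue.IH by (elim exE)
  show ?case
  \<comment> \<open>The summand \<open>nd\<close> puts the gluing value \<open>d\<close> on the
    grid, so that no grid interval straddles it.\<close>
  proof (intro exI[of _ "M1 + M2 + nd"] allI impI)
    fix M and q :: int
    assume M: "M1 + M2 + nd \<le> M" and q: "c \<le> of_int q / 2 ^ M \<and> of_int (q + 1) / 2 ^ M \<le> h"
    obtain r :: int where r: "d = of_int r / 2 ^ M" using nd[of M] M by auto
    show "\<exists>x y. a \<le> x \<and> y \<le> e \<and> std_interval x y \<and>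
        aff f x y (of_int q / 2 ^ M) (of_int (q + 1) / 2 ^ M)"
    proof (cases "q + 1 \<le> r")
      case True
      then have "of_int (q + 1) / 2 ^ M \<le> d" unfolding r by (intro divide_right_mono) (simp_all only: of_int_le_iff, simp)
      then obtain x y where "a \<le> x" "y \<le> b" "std_interval x y"
          "aff f x y (of_int q / 2 ^ M) (of_int (q + 1) / 2 ^ M)"
        using M1 M q by (meson add_leD1)
      then show ?thesis using ab by (intro exI[of _ x] exI[of _ y]) auto
    next
      case False
      then have "d \<le> of_int q / 2 ^ M" unfolding r by (intro divide_right_mono) auto
      then obtain x y where "b \<le> x" "y \<le> e" "std_interval x y"
          "aff f x y (of_int q / 2 ^ M) (of_int (q + 1) / 2 ^ M)"
        using M2 M q by (meson add_leD1 add_leD2)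
      then show ?thesis using ab by (intro exI[of _ x] exI[of _ y]) auto
    qed
  qed
qed

lemma vine_cover: "0 \<le> t \<Longrightarrow> t < vine N \<Longrightarrow> \<exists>i<N. t \<in> {vine i..vine (Suc i)}"
proof (induction N)
  case (Suc N)
  then show ?case
    by (cases "t < vine N") (auto simp: less_Suc_eq)
qed simp

lemma aff_ends:
  assumes "aff f a b c d" "a < b" shows "f a = c" "f b = d"
  using assms by (auto simp: aff_def)

text \<open>A fine uniform partition \<open>c\<close> and its preimage \<open>b\<close> under
  \<open>f\<close> are both standard. If \<open>g\<close> and \<open>g'\<close> carry the same vine
  partition to \<open>c\<close> and \<open>b\<close>, then \<open>f\<close> after \<open>g'\<close>
  agrees with \<open>g\<close> on every piece, so \<open>f\<close> is a quotient of two elements of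
  the subgroup.\<close>

lemma generate_thompson_F: "x01_group = carrier thompson_F"
proof
  interpret H: subgroup x01_group thompson_F by (rule subgroup_x01_group)
  show "x01_group \<subseteq> carrier thompson_F" by (rule H.subset)
  show "carrier thompson_F \<subseteq> x01_group"
  proof
    fix f assume f: "f \<in> carrier thompson_F"
    then have dpl: "dpl f 0 1 0 1" by (simp add: carrier_thompson_F)
    let ?f' = "inv\<^bsub>thompson_F\<^esub> f"
    obtain M where M: "\<And>q::int. 0 \<le> of_int q / (2::real) ^ M \<Longrightarrow> of_int (q + 1) / (2::real) ^ M \<le> 1 \<Longrightarrow>
     (\<exists>x y. 0 \<le> x \<and> y \<le> 1 \<and> std_interval x y \<and> aff f x y (of_int q / 2 ^ M) (of_int (q + 1) / 2 ^ M))"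
      using dpl_std_preimage[OF dpl] by blast
    define N where "N = 2 ^ M - (1::nat)"
    have N: "Suc N = 2 ^ M" by (simp add: N_def)
    define c where "c i = real i / 2 ^ M" for i
    define b where "b i = ?f' (c i)" for i
    have c1: "c (Suc N) = 1" unfolding c_def N by simp
    have step: "std_interval (c i) (c (Suc i)) \<and> std_interval (b i) (b (Suc i)) \<and> aff f (b i) (b (Suc i)) (c i) (c (Suc i))"
      if "i \<le> N" for i
    proof -
      have "real (Suc i) \<le> real (2 ^ M)" using that by (subst N[symmetric]) simp
      then have "c (Suc i) \<le> 1" by (simp add: c_def)
      then obtain x y where xy: "0 \<le> x" "y \<le> 1" "std_interval x y" "aff f x y (c i) (c (Suc i))"
        using M[of "int i"] by (auto simp: c_def algebra_simps)
      have "x < y" using xy(3) by (rule std_interval_less)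
      then have "b i = x" "b (Suc i) = y"
        using aff_ends[OF xy(4)] xy(1,2) thompson_F_inv_apply(1)[OF f, of x] thompson_F_inv_apply(1)[OF f, of y]
        by (simp_all add: b_def)
      moreover have "std_interval (c i) (c (Suc i))"
        unfolding std_interval_def c_def by (intro exI[of _ "int i"] exI[of _ M]) simp
      ultimately show ?thesis using xy by simp
    qed
    have fix01: "?f' 0 = 0" "?f' 1 = 1"
      using thompson_F_inv_apply(1)[OF f, of 0] thompson_F_inv_apply(1)[OF f, of 1] dplD[OF dpl] by auto
    have c0: "c 0 = 0" by (simp add: c_def)
    have b01: "b 0 = 0" "b (Suc N) = 1" using fix01 c0 c1 by (simp_all add: b_def)
    obtain g where g: "g \<in> x01_group" "\<And>i. i < N \<Longrightarrow> aff g (vine i) (vine (Suc i)) (c i) (c (Suc i))"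
      "aff g (vine N) 1 (c N) 1"
      using ex_partition_map[of c N] c0 c1 step by blast
    obtain g' where g': "g' \<in> x01_group" "\<And>i. i < N \<Longrightarrow> aff g' (vine i) (vine (Suc i)) (b i) (b (Suc i))"
      "aff g' (vine N) 1 (b N) 1"
      using ex_partition_map[of b N] b01 step by blast
    have carr: "g \<in> carrier thompson_F" "g' \<in> carrier thompson_F" using g(1) g'(1) by auto
    have "f \<otimes>\<^bsub>thompson_F\<^esub> g' = g"
    proof (rule thompson_F_eqI)
      fix t :: real assume t: "t \<in> {0..1}"
      have "f (g' t) = g t"
      proof (cases "t < vine N")
        case True
        then obtain i where i: "i < N" "t \<in> {vine i..vine (Suc i)}" using vine_cover t by auto
        have "aff (\<lambda>t. f (g' t)) (vine i) (vine (Suc i)) (c i) (c (Suc i))"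
          using step[of i] i(1) vine_less_Suc by (intro aff_comp[OF g'(2)]) (auto intro: std_interval_less)
        then show ?thesis using g(2)[OF i(1)] i(2) by (simp add: aff_def)
      next
        case False
        have "aff (\<lambda>t. f (g' t)) (vine N) 1 (c N) 1"
          using step[of N] vine_lt_1 b01 c1 by (intro aff_comp[OF g'(3)]) (auto dest: std_interval_less)
        then show ?thesis using g(3) False t by (simp add: aff_def)
      qed
      then show "(f \<otimes>\<^bsub>thompson_F\<^esub> g') t = g t" using f carr t by (simp add: thompson_F_mult_apply)
    qed (use f carr in auto)
    then have "f = g \<otimes>\<^bsub>thompson_F\<^esub> inv\<^bsub>thompson_F\<^esub> g'"
      using f carr TF.inv_solve_right by auto
    then show "f \<in> x01_group" using g(1) g'(1) by auto
  qed
qed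

section \<open>Non-cancellation\<close>

text \<open>Indices shift: source index 1 is the composite generator, and target index 1 is
  \<open>u 1\<close>, which is also the image of source index 2. Only syllables of source index 0 or
  2 can therefore interfere with an expanded letter.\<close>

fun expand :: "nat \<Rightarrow> letter \<Rightarrow> letter list" where
  "expand m (0, s) = [(0, s)]"
| "expand m (Suc 0, True) = replicate m (0, True) @ replicate m (1, True)"
| "expand m (Suc 0, False) = replicate m (1, False) @ replicate m (0, False)"
| "expand m (Suc (Suc i), s) = [(Suc i, s)]"

definition subst_word :: "nat \<Rightarrow> letter list \<Rightarrow> letter list" where
  "subst_word m w = concat (map (expand m) w)"

abbreviation reduced_subst :: "nat \<Rightarrow> letter list \<Rightarrow> letter list" where
  "reduced_subst m w \<equiv> foldr cancel_cons (subst_word m w) []"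

section \<open>Exponents of leading syllables\<close>

definition lsgn :: "letter \<Rightarrow> int" where
  "lsgn x = (if snd x then 1 else - 1)"

lemma lsgn_simps [simp]: "lsgn (i, True) = 1" "lsgn (i, False) = - 1"
  by (simp_all add: lsgn_def)

lemma lsgn_inv_letter [simp]: "lsgn (inv_letter x) = - lsgn x"
  by (simp add: lsgn_def inv_letter_def)

lemma lsgn_cases: "lsgn x = 1 \<or> lsgn x = - 1"
  by (simp add: lsgn_def)

text \<open>
  With \<open>c = 0\<close> this is the exponent of the leading syllable in the generator \<open>i\<close>; the offset
  \<open>c\<close> is added if the letter \<open>y\<close> follows that (possibly empty) syllable.
\<close>

fun lead :: "nat \<Rightarrow> letter \<Rightarrow> int \<Rightarrow> letter list \<Rightarrow> int" where
  "lead i y c [] = 0"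
| "lead i y c (x # w) = (if fst x = i then lsgn x + lead i y c w else if x = y then c else 0)"

abbreviation lead0 :: "nat \<Rightarrow> letter list \<Rightarrow> int" where
  "lead0 i \<equiv> lead i (0, True) 0"

lemma lead0_cancel_cons: "fst x = i \<Longrightarrow> lead0 i (cancel_cons x w) = lsgn x + lead0 i w"
  by (cases w) auto

lemma lead0_replicate:
  "lead0 i (foldr cancel_cons (replicate m (i, s)) w) = int m * lsgn (i, s) + lead0 i w"
  by (induction m) (auto simp: lead0_cancel_cons algebra_simps)

lemma lead0_nonzeroD: "lead0 i w \<noteq> 0 \<Longrightarrow> w \<noteq> [] \<and> fst (hd w) = i"
  by (cases w) (auto split: if_splits)

lemma lead0_other: "lead0 i w \<noteq> 0 \<Longrightarrow> j \<noteq> i \<Longrightarrow> lead0 j w = 0"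
  by (cases w) (auto split: if_splits)

text \<open>The letters of one syllable of a reduced word have the same sign, so its exponent is the
  sign of the first letter times the length \<open>k\<close> of the syllable.\<close>

lemma lead_reduced:
  "reduced (x # w) \<Longrightarrow> fst x = i \<Longrightarrow>
    \<exists>k. 1 \<le> k \<and> k \<le> int (length (x # w)) \<and>
      (lead i y c (x # w) = lsgn x * k \<or> lead i y c (x # w) = lsgn x * k + c)"
proof (induction w arbitrary: x)
  case (Cons z w)
  show ?case
  proof (cases "fst z = i")
    case True
    then have "z = x"
      using Cons.prems by (cases x; cases z) (auto simp: reduced_Cons)
    moreover obtain k where "1 \<le> k" "k \<le> int (length (z # w))"
      "lead i y c (z # w) = lsgn z * k \<or> lead i y c (z # w) = lsgn z * k + c"
      using Cons.IH[of z] Cons.prems True by (auto simp: reduced_Cons)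
    ultimately show ?thesis
      using Cons.prems True by (intro exI[of _ "k + 1"]) (auto simp: algebra_simps)
  qed (use Cons.prems in \<open>auto intro!: exI[of _ 1]\<close>)
qed (auto intro!: exI[of _ 1])

lemma lead_reduced_neq:
  assumes "reduced (x # w)" "fst x = i" "int (length (x # w)) < \<bar>c\<bar>"
  shows "lead i y c (x # w) \<noteq> 0" "lead i y c (x # w) \<noteq> c"
proof -
  obtain k where k: "1 \<le> k" "k \<le> int (length (x # w))"
    "lead i y c (x # w) = lsgn x * k \<or> lead i y c (x # w) = lsgn x * k + c"
    using lead_reduced[OF assms(1,2)] by blast
  show "lead i y c (x # w) \<noteq> 0" "lead i y c (x # w) \<noteq> c"
    using k assms(3) lsgn_cases[of x] by (auto simp: abs_if split: if_splits)
qed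

text \<open>The value \<open>c\<close> itself could only come from an empty syllable followed by
  \<open>y\<close>; a nonempty one shifts it by a nonzero amount, and without the offset it is too
  short to reach \<open>c\<close>.\<close>

lemma lead_neq_offset:
  assumes "reduced w" "int (length w) < \<bar>c\<bar>" "w = [] \<or> hd w \<noteq> y"
  shows "lead i y c w \<noteq> c"
proof (cases w)
  case (Cons x v)
  then show ?thesis using assms lead_reduced_neq(2)[of x v i c y] by (cases "fst x = i") auto
qed (use assms in auto)

lemma reduced_subst_Cons:
  "reduced_subst m (x # w) = foldr cancel_cons (expand m x) (reduced_subst m w)"
  by (simp add: subst_word_def)

text \<open>The image of \<open>(1, True)\<close> starts with a^m and that of
  \<open>(1, False)\<close> with b_1^(-m); these are the only images of composite letters that can
  prolong a preceding syllable of index 0 or 2, whence the two offsets. Being shorter than m, such a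
  syllable is never absorbed, and what is left of it separates the letters in front from the
  rest.\<close>

lemma lead_reduced_subst:
  assumes "reduced w" "length w < m"
  shows "lead0 0 (reduced_subst m w) = lead 0 (1, True) (int m) w \<and>
    lead0 1 (reduced_subst m w) = lead 2 (1, False) (- int m) w \<and>
    (\<forall>i s. i \<ge> 2 \<longrightarrow> (reduced_subst m w \<noteq> [] \<and> hd (reduced_subst m w) = (i, s) \<longleftrightarrow>
       w \<noteq> [] \<and> hd w = (Suc i, s)))"
  using assms
proof (induction w)
  case Nil
  then show ?case by (simp add: subst_word_def)
next
  case (Cons x w)
  define r where "r = reduced_subst m w"
  define r' where "r' = reduced_subst m (x # w)"
  note red = Cons.prems(1) and len = Cons.prems(2)
  have "lead0 0 r' = lead 0 (1, True) (int m) (x # w) \<and> lead0 1 r' = lead 2 (1, False) (- int m) (x # w) \<and>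
      (\<forall>i s. i \<ge> 2 \<longrightarrow> (r' \<noteq> [] \<and> hd r' = (i, s) \<longleftrightarrow> hd (x # w) = (Suc i, s)))"
  proof -
    have w: "reduced w" "length w < m" "w = [] \<or> hd w \<noteq> inv_letter x"
      using red len by (auto simp: reduced_Cons)
    have IH: "lead0 0 r = lead 0 (1, True) (int m) w" "lead0 1 r = lead 2 (1, False) (- int m) w"
      "\<And>i s. i \<ge> 2 \<Longrightarrow> (r \<noteq> [] \<and> hd r = (i, s)) \<longleftrightarrow> (w \<noteq> [] \<and> hd w = (Suc i, s))"
      using Cons.IH w unfolding r_def by blast+
    have r': "r' = foldr cancel_cons (expand m x) r" unfolding r_def r'_def by (rule reduced_subst_Cons)
    obtain j s where x: "x = (j, s)" by (cases x)
    have jc: "j = 0 \<or> j = 1 \<or> j = 2 \<or> (j = Suc (j - 1) \<and> j - 1 \<ge> 2)" by linarith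
    consider "j = 0" | "j = 1" "s" | "j = 1" "\<not> s" | "j = 2" | k where "j = Suc k" "k \<ge> 2"
      using jc by blast
    then show ?thesis
    proof cases
      case 1
      then have "lead0 0 r' = lead 0 (1, True) (int m) (x # w)"
        using r' x IH(1) by (simp add: lead0_cancel_cons)
      moreover have "\<dots> \<noteq> 0" using lead_reduced_neq(1)[OF red] len x 1 by simp
      ultimately show ?thesis
        using lead0_nonzeroD[of 0 r'] lead0_other[of 0 r' 1] x 1 by auto
    next
      case 2
      define q where "q = foldr cancel_cons (replicate m (1, True)) r"
      have r'q: "r' = foldr cancel_cons (replicate m (0, True)) q" using r' x 2 by (simp add: q_def)
      \<comment> \<open>As the word is reduced, \<open>w\<close> does not start with the inverse of
        \<open>x\<close>. So the new b_1^m is not cancelled completely, and its nonempty remainder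
        protects a^m.\<close>
      have "lead 2 (1, False) (- int m) w \<noteq> - int m"
        using w len x 2 by (intro lead_neq_offset) auto
      then have "lead0 1 q \<noteq> 0" unfolding q_def lead0_replicate using IH(2) by simp
      then have "lead0 0 q = 0" by (intro lead0_other[of 1 q 0]) auto
      then have "lead0 0 r' = int m" unfolding r'q lead0_replicate by simp
      then show ?thesis
        using lead0_nonzeroD[of 0 r'] lead0_other[of 0 r' 1] x 2 len by auto
    next
      case 3
      define q where "q = foldr cancel_cons (replicate m (0, False)) r"
      have r'q: "r' = foldr cancel_cons (replicate m (1, False)) q" using r' x 3 by (simp add: q_def)
      \<comment> \<open>The mirror image: here a remainder of a^(-m) protects b_1^(-m).\<close>
      have "lead 0 (1, True) (int m) w \<noteq> int m"
        using w len x 3 by (intro lead_neq_offset) auto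
      then have "lead0 0 q \<noteq> 0" unfolding q_def lead0_replicate using IH(1) by simp
      then have "lead0 1 q = 0" by (intro lead0_other[of 0 q 1]) auto
      then have "lead0 1 r' = - int m" unfolding r'q lead0_replicate by simp
      then show ?thesis
        using lead0_nonzeroD[of 1 r'] lead0_other[of 1 r' 0] x 3 len by auto
    next
      case 4
      then have "lead0 1 r' = lead 2 (1, False) (- int m) (x # w)"
        using r' x IH(2) by (simp add: lead0_cancel_cons numeral_2_eq_2 lsgn_def)
      moreover have "\<dots> \<noteq> 0" using lead_reduced_neq(1)[OF red] len x 4 by simp
      ultimately show ?thesis
        using lead0_nonzeroD[of 1 r'] lead0_other[of 1 r' 0] x 4 by auto
    next
      case 5
      have "expand m x = [(k, s)]" using x 5 by (cases k) auto
      moreover have "\<not> (r \<noteq> [] \<and> hd r = (k, \<not> s))" using IH(3)[of k "\<not> s"] w(3) x 5 by auto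
      ultimately have "r' = (k, s) # r" using r' by (cases r) auto
      then show ?thesis using x 5 by auto
    qed
  qed
  then show ?case unfolding r'_def by simp
qed

lemma reduced_subst_nonempty:
  assumes "reduced w" "length w < m" "w \<noteq> []"
  shows "reduced_subst m w \<noteq> []"
proof
  assume empty: "reduced_subst m w = []"
  obtain x v where w: "w = x # v" using assms(3) by (cases w) auto
  obtain i s where x: "x = (i, s)" by (cases x)
  have 0: "lead 0 (1, True) (int m) w = 0" "lead 2 (1, False) (- int m) w = 0"
    using lead_reduced_subst[OF assms(1,2)] empty by simp_all
  have red: "reduced (x # v)" and len: "int (length (x # v)) < \<bar>int m\<bar>" "int (length (x # v)) < \<bar>- int m\<bar>"
    using assms(1,2) w by auto
  have "i \<noteq> 0" "i \<noteq> 2"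
    using lead_reduced_neq(1)[OF red _ len(1)] lead_reduced_neq(1)[OF red _ len(2)] 0 x unfolding w
    by (metis fst_conv)+
  moreover have "i \<noteq> 1" using 0 w x assms(2) by (cases s) auto
  ultimately obtain k where "i = Suc k" "k \<ge> 2" by (cases i) auto
  then show False using lead_reduced_subst[OF assms(1,2)] empty w x by auto
qed

lemma length_subst_word: "m \<ge> 1 \<Longrightarrow> length (subst_word m w) \<le> 2 * m * length w"
proof (induction w)
  case (Cons x w)
  have "length (expand m x) \<le> 2 * m" using Cons.prems by (cases "(m, x)" rule: expand.cases) auto
  then show ?case using Cons by (simp add: subst_word_def)
qed (simp add: subst_word_def)

lemma set_expand: "l \<ge> 3 \<Longrightarrow> fst x < l \<Longrightarrow> fst ` set (expand m x) \<subseteq> {..<l - 1}"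
  by (cases "(m, x)" rule: expand.cases) auto

lemma set_subst_word: "l \<ge> 3 \<Longrightarrow> fst ` set w \<subseteq> {..<l} \<Longrightarrow> fst ` set (subst_word m w) \<subseteq> {..<l - 1}"
proof (induction w)
  case (Cons x w)
  then have "fst ` set (expand m x) \<subseteq> {..<l - 1}" by (intro set_expand) auto
  then show ?case using Cons by (simp add: subst_word_def image_Un)
qed (simp add: subst_word_def)

section \<open>Convergence\<close>

lemma thompson_x0_le: "t \<in> {0..1} \<Longrightarrow> thompson_x0 t \<le> t"
  by (auto simp: thompson_x0_def)

lemma inv_thompson_x0_le:
  assumes "t \<in> {0..1}" shows "(inv\<^bsub>thompson_F\<^esub> thompson_x0) t \<le> 2 * t"
proof -
  let ?s = "(inv\<^bsub>thompson_F\<^esub> thompson_x0) t"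
  have "?s \<in> {0..1}" "thompson_x0 ?s = t"
    using assms thompson_x0_in_F thompson_F_inv_apply(2)
      thompson_F_range[of "inv\<^bsub>thompson_F\<^esub> thompson_x0" t] by auto
  then show ?thesis by (auto simp: thompson_x0_def split: if_splits)
qed

lemma thompson_x1_fixes:
  assumes "t \<in> {0..1/2}"
  shows "thompson_x 1 t = t" "(inv\<^bsub>thompson_F\<^esub> (thompson_x 1)) t = t"
proof -
  show "thompson_x 1 t = t" using assms thompson_x_vine(1)[of t 1] by (simp add: vine_def)
  then show "(inv\<^bsub>thompson_F\<^esub> (thompson_x 1)) t = t"
    using thompson_F_inv_apply(1)[OF thompson_x_in_F, of t 1] assms by auto
qed

lemma thompson_F_less_iff:
  assumes "f \<in> carrier thompson_F" "s \<in> {0..1}" "t \<in> {0..1}"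
  shows "f s < f t \<longleftrightarrow> s < t"
  using assms dpl_less[of f 0 1 0 1 s t] dpl_le[of f 0 1 0 1 t s]
  by (auto simp: carrier_thompson_F not_less[symmetric])

lemma support_fixes:
  assumes "support f \<subseteq> {0..<e}" "t \<in> {0..1}" "e \<le> t" shows "f t = t"
proof (rule ccontr)
  assume "f t \<noteq> t"
  then have "t \<in> support f" using assms(2) closure_subset by (force simp: support_def)
  then show False using assms by auto
qed

text \<open>An increasing map that fixes everything from \<open>e\<close> on maps
  \<open>[0, e)\<close> into itself, so a bound \<open>K\<close> beyond \<open>e\<close> is never
  crossed. When \<open>e\<close> exceeds 1, the range of the map already gives the bound.\<close>

lemma support_preserves:
  assumes f: "f \<in> carrier thompson_F" "support f \<subseteq> {0..<e}" and e: "0 < e" "e \<le> K"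
    and t: "t \<in> {0..1}" "t < K"
  shows "f t < K" "(inv\<^bsub>thompson_F\<^esub> f) t < K"
proof -
  have fixed: "f s = s \<and> (inv\<^bsub>thompson_F\<^esub> f) s = s" if "s \<in> {0..1}" "e \<le> s" for s
    using support_fixes[OF f(2) that] thompson_F_inv_apply(1)[OF f(1) that(1)] by simp
  show "f t < K"
  proof (cases "t < e \<and> e \<le> 1")
    case True
    then have "f t < f e" using thompson_F_less_iff[OF f(1), of t e] t e by auto
    then show ?thesis using fixed[of e] True e by auto
  next
    case False
    show ?thesis
    proof (cases "e \<le> t")
      case False
      then show ?thesis
        using \<open>\<not> (t < e \<and> e \<le> 1)\<close> thompson_F_range[OF f(1) t(1)] e by auto
    qed (use fixed[of t] t in auto)
  qed
  let ?g = "inv\<^bsub>thompson_F\<^esub> f"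
  have g: "?g \<in> carrier thompson_F" using f(1) by simp
  show "?g t < K"
  proof (cases "t < e \<and> e \<le> 1")
    case True
    then have "?g t < ?g e" using thompson_F_less_iff[OF g, of t e] t e by auto
    then show ?thesis using fixed[of e] True e by auto
  next
    case False
    show ?thesis
    proof (cases "e \<le> t")
      case False
      then show ?thesis
        using \<open>\<not> (t < e \<and> e \<le> 1)\<close> thompson_F_range[OF g t(1)] e by auto
    qed (use fixed[of t] t in auto)
  qed
qed

text \<open>The predicate depends on the exponent because the bound for powers of the inverse of
  \<open>thompson_x0\<close> doubles with every factor.\<close>

lemma thompson_F_pow_induct:
  assumes f: "f \<in> carrier thompson_F" and t: "t \<in> {0..1}" "P (0::nat) t"
    and step: "\<And>n s. s \<in> {0..1} \<Longrightarrow> P n s \<Longrightarrow> P (Suc n) (f s)"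
  shows "P n ((f [^]\<^bsub>thompson_F\<^esub> n) t)"
proof (induction n)
  case 0
  then show ?case using t by (simp add: thompson_F_one_apply)
next
  case (Suc n)
  have "(f [^]\<^bsub>thompson_F\<^esub> Suc n) t = f ((f [^]\<^bsub>thompson_F\<^esub> n) t)"
    using f t by (simp only: TF.nat_pow_Suc2) (simp add: thompson_F_mult_apply)
  then show ?case
    using step[OF thompson_F_range[OF TF.nat_pow_closed[OF f] t(1)] Suc] by simp
qed

lemma pow_support_preserves:
  assumes "f \<in> carrier thompson_F" "support f \<subseteq> {0..<e}" "0 < e" "e \<le> K" "t \<in> {0..1}" "t < K"
  shows "(f [^]\<^bsub>thompson_F\<^esub> (n::nat)) t < K" "((inv\<^bsub>thompson_F\<^esub> f) [^]\<^bsub>thompson_F\<^esub> n) t < K"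
  using assms
  by (auto intro!: thompson_F_pow_induct[where P = "\<lambda>_ s. s < K"] intro: support_preserves)

lemma pow_thompson_x0_less:
  "t \<in> {0..1} \<Longrightarrow> t < K \<Longrightarrow> (thompson_x0 [^]\<^bsub>thompson_F\<^esub> (n::nat)) t < K"
  by (rule thompson_F_pow_induct[where P = "\<lambda>_ s. s < K"])
    (auto simp: thompson_x0_in_F intro: le_less_trans[OF thompson_x0_le])

lemma pow_inv_thompson_x0_less:
  assumes "t \<in> {0..1}" "t < K"
  shows "((inv\<^bsub>thompson_F\<^esub> thompson_x0) [^]\<^bsub>thompson_F\<^esub> (n::nat)) t < 2 ^ n * K"
proof (rule thompson_F_pow_induct[where P = "\<lambda>n s. s < 2 ^ n * K"])
  show "(inv\<^bsub>thompson_F\<^esub> thompson_x0) s < 2 ^ Suc n * K" if "s \<in> {0..1}" "s < 2 ^ n * K" for n s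
    using inv_thompson_x0_le[OF that(1)] that(2) by simp
qed (use assms thompson_x0_in_F in auto)

text \<open>
  Before \<open>x\<^sub>1\<close> is applied, all points of the orbit lie in \<open>[0, 1/2]\<close>, where \<open>x\<^sub>1\<close> is the identity.
\<close>

lemma word_eval_F_marking:
  assumes l: "l \<ge> 3" and m: "m \<ge> 1" and e: "0 < e" "2 ^ (m * length w) * e < 1 / 2"
    and u: "\<And>i. i \<in> {1..l-2} \<Longrightarrow> u i \<in> carrier thompson_F \<and> support (u i) \<subseteq> {0..<e}"
    and w: "fst ` set w \<subseteq> {..<l}" and t: "t \<in> {0..<e}"
  shows "word_eval thompson_F (snd (F_marking l m u)) w t =
      word_eval thompson_F (thompson_x0 # map u [1..<l-1]) (subst_word m w) t \<and>
    word_eval thompson_F (thompson_x0 # map u [1..<l-1]) (subst_word m w) t < 2 ^ (m * length w) * e"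
  using e(2) w
proof (induction w)
  case Nil
  then show ?case using t by (simp add: subst_word_def thompson_F_one_apply)
next
  case (Cons x w)
  let ?hs = "snd (F_marking l m u)" and ?gs = "thompson_x0 # map u [1..<l-1]"
  let ?E = "\<lambda>v. word_eval thompson_F ?gs v"
  have gs: "set ?gs \<subseteq> carrier thompson_F" using u thompson_x0_in_F by auto
  have len: "length ?gs = l - 1" using l by simp
  have u1: "u 1 \<in> carrier thompson_F" "support (u 1) \<subseteq> {0..<e}" using u[of 1] l by auto
  have hs: "set ?hs \<subseteq> carrier thompson_F" "length ?hs = l"
    using u u1(1) thompson_x0_in_F thompson_x_in_F l by (auto simp: F_marking_def)
  have e1: "e < 1 / 2"
  proof -
    have "1 * e \<le> 2 ^ (m * length (x # w)) * e" using e(1) by (intro mult_right_mono) auto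
    then show ?thesis using Cons.prems by linarith
  qed
  have t1: "t \<in> {0..1}" using t e1 by auto
  \<comment> \<open>The bound for the orbit after the suffix \<open>w\<close> has acted; the letter
    \<open>x\<close> may enlarge it by a factor of at most 2^m.\<close>
  define K where "K = 2 ^ (m * length w) * e"
  have K2: "2 ^ (m * length (x # w)) * e = 2 ^ m * K" by (simp add: K_def power_add)
  have "K \<le> 2 ^ m * K" using e(1) by (simp add: K_def)
  have "2 * K \<le> 2 ^ m * K"
  proof -
    have "(2::real) ^ 1 \<le> 2 ^ m" using m by (intro power_increasing) auto
    then show ?thesis using e(1) by (simp add: K_def)
  qed
  have Khalf: "2 ^ m * K < 1 / 2" using Cons.prems(1) K2 by simp
  have eK: "e \<le> K" unfolding K_def using e(1) by simp
  have w: "fst ` set w \<subseteq> {..<l}" "fst x < l" using Cons.prems by auto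
  have sw: "fst ` set (subst_word m w) \<subseteq> {..<length ?gs}"
    using set_subst_word[OF l w(1)] len by simp
  define s where "s = ?E (subst_word m w) t"
  have Ecarr: "?E (subst_word m w) \<in> carrier thompson_F" using gs sw by (rule TF.word_eval_closed)
  have Hcarr: "word_eval thompson_F ?hs w \<in> carrier thompson_F"
    using hs w by (intro TF.word_eval_closed) auto
  have "K < 1 / 2" using \<open>K \<le> 2 ^ m * K\<close> Khalf by linarith
  then have IH: "word_eval thompson_F ?hs w t = s" "s < K"
    using Cons.IH w(1) unfolding s_def K_def by auto
  have s01: "s \<in> {0..1}" unfolding s_def by (rule thompson_F_range[OF Ecarr t1])
  have xs: "fst ` set (expand m x) \<subseteq> {..<length ?gs}" using set_expand[OF l w(2)] len by simp
  have xcarr: "?E (expand m x) \<in> carrier thompson_F" using gs xs by (rule TF.word_eval_closed)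
  have nth01: "?gs ! 0 = thompson_x0" "?gs ! 1 = u 1" using l by (simp_all del: upt_Suc)
  have E2: "?E (replicate m (i, b) @ replicate m (j, b)) =
      (if b then ?gs ! i else inv\<^bsub>thompson_F\<^esub> (?gs ! i)) [^]\<^bsub>thompson_F\<^esub> m \<otimes>\<^bsub>thompson_F\<^esub>
      (if b then ?gs ! j else inv\<^bsub>thompson_F\<^esub> (?gs ! j)) [^]\<^bsub>thompson_F\<^esub> m"
    if "i < length ?gs" "j < length ?gs" for i j b
  proof -
    have "fst ` set (replicate m (i, b) @ replicate m (j, b)) \<subseteq> {..<length ?gs}" using that by auto
    from TF.word_eval_append[OF gs this] show ?thesis
      by (simp only: TF.word_eval_replicate[OF gs] that)
  qed
  have l01: "0 < length ?gs" "1 < length ?gs" using len l by auto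
  define g where "g = (if snd x then ?hs ! fst x else inv\<^bsub>thompson_F\<^esub> (?hs ! fst x))"
  have "?hs ! fst x \<in> carrier thompson_F" using hs w(2) by (metis nth_mem subsetD)
  then have gcarr: "g \<in> carrier thompson_F" unfolding g_def by simp
  have "word_eval thompson_F ?hs (x # w) t = g s"
    using thompson_F_mult_apply[OF gcarr Hcarr t1] IH(1) by (simp add: g_def)
  moreover have "?E (subst_word m (x # w)) t = ?E (expand m x) s"
  proof -
    have "fst ` set (expand m x @ subst_word m w) \<subseteq> {..<length ?gs}"
      using xs sw by (simp only: set_append image_Un Un_subset_iff)
    from TF.word_eval_append[OF gs this]
    have "?E (subst_word m (x # w)) = ?E (expand m x) \<otimes>\<^bsub>thompson_F\<^esub> ?E (subst_word m w)"
      by (simp only: subst_word_def list.map concat.simps)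
    then show ?thesis using thompson_F_mult_apply[OF xcarr Ecarr t1] by (simp only: s_def)
  qed
  moreover have "g s = ?E (expand m x) s \<and> g s < 2 ^ m * K"
  proof -
    obtain i b where x: "x = (i, b)" by (cases x)
    consider "i = 0" | "i = 1" "b" | "i = 1" "\<not> b" | j where "i = Suc (Suc j)"
      by (metis One_nat_def not0_implies_Suc)
    then show ?thesis
    proof cases
      case 1
      then have "g = (if b then thompson_x0 else inv\<^bsub>thompson_F\<^esub> thompson_x0)"
        unfolding g_def x by (simp add: F_marking_def)
      moreover have "?E (expand m x) = (if b then thompson_x0 else inv\<^bsub>thompson_F\<^esub> thompson_x0)"
        unfolding x 1 using thompson_x0_in_F by simp
      moreover have "g s < 2 * K"
        using inv_thompson_x0_le[OF s01] thompson_x0_le[OF s01] IH(2) s01 calculation(1) by auto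
      ultimately show ?thesis using \<open>2 * K \<le> 2 ^ m * K\<close> by simp
    next
      case 2
      let ?v = "thompson_x0 [^]\<^bsub>thompson_F\<^esub> m" and ?u = "u 1 [^]\<^bsub>thompson_F\<^esub> m"
      have c: "?v \<in> carrier thompson_F" "?u \<in> carrier thompson_F"
        using thompson_x0_in_F u1 by auto
      have "g = ?v \<otimes>\<^bsub>thompson_F\<^esub> ?u \<otimes>\<^bsub>thompson_F\<^esub> thompson_x 1"
        unfolding g_def x using 2 by (simp add: F_marking_def)
      then have "g s = ?v (?u (thompson_x 1 s))"
        using c thompson_x_in_F s01 thompson_F_range by (simp add: thompson_F_mult_apply)
      then have gs': "g s = ?v (?u s)"
        using thompson_x1_fixes(1)[of s] s01 IH(2) \<open>K < 1 / 2\<close> by auto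
      have "?E (expand m x) = ?v \<otimes>\<^bsub>thompson_F\<^esub> ?u"
        using E2[OF l01, of True] 2 unfolding x nth01 by simp
      then have "?E (expand m x) s = ?v (?u s)" using c s01 by (simp add: thompson_F_mult_apply)
      moreover have "?u s < K" by (intro pow_support_preserves[OF u1 e(1) eK] s01 IH)
      then have "?v (?u s) < K" using thompson_F_range[OF c(2) s01] by (intro pow_thompson_x0_less)
      ultimately show ?thesis using gs' \<open>K \<le> 2 ^ m * K\<close> by simp
    next
      case 3
      let ?v = "(inv\<^bsub>thompson_F\<^esub> thompson_x0) [^]\<^bsub>thompson_F\<^esub> m"
        and ?u = "(inv\<^bsub>thompson_F\<^esub> u 1) [^]\<^bsub>thompson_F\<^esub> m"
      have c: "?v \<in> carrier thompson_F" "?u \<in> carrier thompson_F"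
        using thompson_x0_in_F u1 by auto
      \<comment> \<open>Here the inverse of x_1 acts last, when the powers of the inverse of x_0
        have already moved the point to the right; the full bound 2^m K below 1/2 is what keeps it
        fixed.\<close>
      have "g = inv\<^bsub>thompson_F\<^esub> thompson_x 1 \<otimes>\<^bsub>thompson_F\<^esub> (?u \<otimes>\<^bsub>thompson_F\<^esub> ?v)"
        unfolding g_def x using 3 thompson_x0_in_F u1 thompson_x_in_F
        by (simp add: F_marking_def TF.inv_mult_group TF.nat_pow_inv)
      then have gs': "g s = (inv\<^bsub>thompson_F\<^esub> thompson_x 1) (?u (?v s))"
        using c thompson_x_in_F s01 thompson_F_range by (simp add: thompson_F_mult_apply)
      have "?E (expand m x) = ?u \<otimes>\<^bsub>thompson_F\<^esub> ?v"
        using E2[OF l01(2,1), of False] 3 unfolding x nth01 by simp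
      then have "?E (expand m x) s = ?u (?v s)" using c s01 by (simp add: thompson_F_mult_apply)
      moreover have v: "?v s < 2 ^ m * K" using s01 IH(2) by (rule pow_inv_thompson_x0_less)
      have "?v s \<in> {0..1}" using c(1) s01 by (rule thompson_F_range)
      then have uv: "?u (?v s) < 2 ^ m * K" "?u (?v s) \<in> {0..1}"
        using pow_support_preserves(2)[OF u1 e(1) _ _ v] eK \<open>K \<le> 2 ^ m * K\<close> thompson_F_range[OF c(2)]
        by auto
      then have "(inv\<^bsub>thompson_F\<^esub> thompson_x 1) (?u (?v s)) = ?u (?v s)"
        using Khalf by (intro thompson_x1_fixes) auto
      ultimately show ?thesis using gs' uv by simp
    next
      case 4
      have nth: "?hs ! i = u (Suc j)" "?gs ! Suc j = u (Suc j)" "Suc j \<in> {1..l-2}"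
        using 4 w(2) x by (auto simp: F_marking_def simp del: upt_Suc)
      have "g = (if b then u (Suc j) else inv\<^bsub>thompson_F\<^esub> u (Suc j))"
        unfolding g_def x using nth by simp
      moreover have "?E (expand m x) = (if b then u (Suc j) else inv\<^bsub>thompson_F\<^esub> u (Suc j))"
        unfolding x 4 using nth u by auto
      moreover have "g s < K"
        using support_preserves[OF _ _ e(1) eK s01 IH(2), of "u (Suc j)"] u[OF nth(3)] calculation(1) by auto
      ultimately show ?thesis using \<open>K \<le> 2 ^ m * K\<close> by simp
    qed
  qed
  ultimately show ?case unfolding K2 by simp
qed

text \<open>The left factor \<open>y\<close> of the second generator is a product of powers of other
  generators, so x_1 is recovered by cancelling it, and x_0 with x_1 generate F.\<close>

lemma marked_group_F_marking:
  assumes l: "l \<ge> 3" and u: "\<And>i. i \<in> {1..l-2} \<Longrightarrow> u i \<in> carrier thompson_F"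
  shows "marked_group l (F_marking l m u)"
proof -
  define y where "y = thompson_x0 [^]\<^bsub>thompson_F\<^esub> m \<otimes>\<^bsub>thompson_F\<^esub> u 1 [^]\<^bsub>thompson_F\<^esub> m"
  let ?S = "set (snd (F_marking l m u))"
  have S: "?S = {thompson_x0, y \<otimes>\<^bsub>thompson_F\<^esub> thompson_x 1} \<union> u ` {1..<l-1}"
    by (auto simp: F_marking_def y_def)
  have u1: "u 1 \<in> carrier thompson_F" using u[of 1] l by simp
  then have y: "y \<in> carrier thompson_F" using thompson_x0_in_F by (simp add: y_def)
  have Sc: "?S \<subseteq> carrier thompson_F"
    unfolding S using u y thompson_x0_in_F thompson_x_in_F by auto
  interpret H: subgroup "generate thompson_F ?S" thompson_F
    using Sc by (rule TF.generate_is_subgroup)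
  have x0: "thompson_x0 \<in> generate thompson_F ?S" by (rule generate.incl) (simp add: S)
  have "u 1 \<in> generate thompson_F ?S" by (rule generate.incl) (use l in \<open>auto simp: S\<close>)
  moreover have "z [^]\<^bsub>thompson_F\<^esub> k \<in> generate thompson_F ?S" if "z \<in> generate thompson_F ?S"
    for z and k :: nat
    using that by (induction k) auto
  ultimately have "y \<in> generate thompson_F ?S" using x0 unfolding y_def by auto
  moreover have "y \<otimes>\<^bsub>thompson_F\<^esub> thompson_x 1 \<in> generate thompson_F ?S" by (rule generate.incl) (simp add: S)
  ultimately have "inv\<^bsub>thompson_F\<^esub> y \<otimes>\<^bsub>thompson_F\<^esub> (y \<otimes>\<^bsub>thompson_F\<^esub> thompson_x 1) \<in> generate thompson_F ?S"
    by blast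
  moreover have "inv\<^bsub>thompson_F\<^esub> y \<otimes>\<^bsub>thompson_F\<^esub> (y \<otimes>\<^bsub>thompson_F\<^esub> thompson_x 1) = thompson_x 1"
    using y thompson_x_in_F by (simp add: TF.m_assoc[symmetric])
  ultimately have "{thompson_x0, thompson_x 1} \<subseteq> generate thompson_F ?S" using x0 by auto
  then have "x01_group \<subseteq> generate thompson_F ?S"
    unfolding x01_group_def by (rule TF.generate_subgroup_incl[OF _ H.subgroup_axioms])
  then have "generate thompson_F ?S = carrier thompson_F"
    using H.subset generate_thompson_F by auto
  moreover have "length (snd (F_marking l m u)) = l" "fst (F_marking l m u) = thompson_F"
    using l by (auto simp: F_marking_def)
  ultimately show ?thesis using Sc group_thompson_F by (simp add: marked_group_def)
qed

text \<open>The condition that \<open>m\<close> exceeds \<open>R\<close> acts three times: short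
  syllables cannot absorb m-th powers, the substituted word stays within length 2m^2, and the orbit
  bound stays below 2^(m^2) e.\<close>

lemma same_relations_F_marking:
  assumes l: "l \<ge> 3" and R: "R < m" and e: "0 < e" "2 ^ (m\<^sup>2) * e < 1 / 2" and adm: "admissible l m e u"
  shows "same_relations_upto l R (F_marking l m u) (free_group l, free_basis l)"
proof -
  let ?gs = "thompson_x0 # map u [1..<l-1]"
  have u: "u i \<in> carrier thompson_F \<and> support (u i) \<subseteq> {0..<e}" if "i \<in> {1..l-2}" for i
    using adm that by (auto simp: admissible_def)
  have gs: "set ?gs \<subseteq> carrier thompson_F" using u thompson_x0_in_F by auto
  have fst: "fst (F_marking l m u) = thompson_F" by (simp add: F_marking_def)
  have m: "m \<ge> 1" using R by simp
  have "word_eval thompson_F (snd (F_marking l m u)) w \<noteq> \<one>\<^bsub>thompson_F\<^esub>"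
    if w: "w \<in> carrier (free_group l)" "length w \<le> R" "w \<noteq> []" for w
  proof
    assume triv: "word_eval thompson_F (snd (F_marking l m u)) w = \<one>\<^bsub>thompson_F\<^esub>"
    have red: "reduced w" and idx: "fst ` set w \<subseteq> {..<l}" using w by (auto simp: free_group_def)
    have sub: "fst ` set (subst_word m w) \<subseteq> {..<l - 1}" using l idx by (rule set_subst_word)
    let ?v = "reduced_subst m w"
    have "?v \<in> carrier (free_group (l - 1))"
      using sub set_foldr_cancel_cons[of "subst_word m w" "[]"]
      by (auto simp: free_group_def reduced_foldr_cancel_cons)
    moreover have "?v \<noteq> \<one>\<^bsub>free_group (l - 1)\<^esub>"
      using reduced_subst_nonempty[of w m] red w R by (simp add: free_group_def)
    moreover have "length ?v \<le> 2 * m\<^sup>2"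
    proof -
      have "length ?v \<le> 2 * m * length w"
        using length_foldr_cancel_cons[of "subst_word m w" "[]"] length_subst_word[OF m, of w] by simp
      also have "\<dots> \<le> 2 * m * m" using w R by (intro mult_le_mono) auto
      finally show ?thesis by (simp add: power2_eq_square)
    qed
    ultimately obtain t where t: "t \<in> {0..<e}" "word_eval thompson_F ?gs ?v t \<noteq> t"
      using adm unfolding admissible_def by blast
    have "m * length w \<le> m\<^sup>2" using w R by (simp add: power2_eq_square)
    then have "(2::real) ^ (m * length w) \<le> 2 ^ m\<^sup>2" by (intro power_increasing) auto
    then have "2 ^ (m * length w) * e \<le> 2 ^ m\<^sup>2 * e" using e(1) by (intro mult_right_mono) auto
    then have bound: "2 ^ (m * length w) * e < 1 / 2" using e(2) by linarith
    have "1 * e \<le> 2 ^ m\<^sup>2 * e" using e(1) by (intro mult_right_mono) auto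
    then have "e < 1 / 2" using e(2) by linarith
    then have t1: "t \<in> {0..1}" using t(1) by auto
    \<comment> \<open>The orbit bound follows the unreduced substitution, while
      \<open>admissible\<close> speaks of reduced words; both have the same value.\<close>
    have "word_eval thompson_F ?gs ?v = word_eval thompson_F ?gs (subst_word m w)"
      using sub l by (intro TF.word_eval_foldr_cancel_cons[OF gs]) auto
    then have "word_eval thompson_F ?gs ?v t = \<one>\<^bsub>thompson_F\<^esub> t"
      using word_eval_F_marking[where u = u, OF l m e(1) bound u idx t(1)] triv by simp
    then show False using t(2) thompson_F_one_apply[OF t1] by simp
  qed
  moreover have "[] \<in> carrier (free_group l)" by (simp add: free_group_def)
  ultimately show ?thesis
    unfolding same_relations_upto_def relations_def fst
    by (auto simp: word_eval_free_basis word_eval_def[of _ _ "[]"]) (auto simp: free_group_def)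
qed

lemma F_marking_converges:
  assumes l: "l \<ge> 3" and adm: "\<And>m. m \<ge> 1 \<Longrightarrow> 0 < \<epsilon> m \<and> 2 ^ (m\<^sup>2) * \<epsilon> m < 1 / 2 \<and> admissible l m (\<epsilon> m) (u m)"
  shows "(\<lambda>m. marked_dist l (F_marking l m (u m)) (free_group l, free_basis l)) \<longlonglongrightarrow> 0"
proof (rule LIMSEQ_I)
  fix r :: real assume "0 < r"
  obtain R :: nat where R: "- ln r < real R" using reals_Archimedean2 by blast
  have "exp (- real R) < exp (ln r)" using R by simp
  then have "exp (- real R) < r" using \<open>0 < r\<close> by simp
  moreover have "0 \<le> marked_dist l (F_marking l m (u m)) (free_group l, free_basis l)" for m
    unfolding marked_dist_def
    using same_relations_upto_0[of l "F_marking l m (u m)" "(free_group l, free_basis l)"]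
    by (intro cInf_greatest) (blast, auto)
  moreover have "marked_dist l (F_marking l m (u m)) (free_group l, free_basis l) \<le> exp (- real R)"
    if "m \<ge> Suc R" for m
    using adm[of m] that l unfolding marked_dist_le_iff
    by (intro same_relations_F_marking[of l R m "\<epsilon> m"]) auto
  ultimately show "\<exists>no. \<forall>m\<ge>no. norm (marked_dist l (F_marking l m (u m)) (free_group l, free_basis l) - 0) < r"
    by (intro exI[of _ "Suc R"]) (auto intro: le_less_trans)
qed

section \<open>Elements without short mixed relations\<close>

lemma dpl_glue_if:
  assumes "dpl f a b c d" "dpl g b e d h"
  shows "dpl (\<lambda>t. if t \<le> b then f t else g t) a e c h"
proof (rule dpl.glue)
  show "dpl (\<lambda>t. if t \<le> b then f t else g t) a b c d"
    using assms(1) by (rule dpl_cong) auto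
  show "dpl (\<lambda>t. if t \<le> b then f t else g t) b e d h"
    using assms(2)
  proof (rule dpl_cong)
    fix t assume "t \<in> {b..e}"
    then show "(if t \<le> b then f t else g t) = g t"
      using dplD(8)[OF assms(1)] dplD(7)[OF assms(2)] by (cases "t = b") auto
  qed
qed

lemma dpl_affine_map:
  assumes "a < b" "dyad a" "dyad b" "dyad c" "d - c = 2 powi k * (b - a)"
  shows "dpl (\<lambda>t. c + 2 powi k * (t - a)) a b c d"
proof (rule dpl.affine[of a b c d k])
  have "dyad (c + 2 powi k * (b - a))" using assms by (intro dyad_intros)
  moreover have "d = c + 2 powi k * (b - a)" using assms(5) by simp
  ultimately show "dyad d" by simp
qed (use assms in auto)

text \<open>Stretching by n need not be possible with one power of 2. Instead the left half is
  stretched onto \<open>[0, 1]\<close> and the right half, by induction, onto the remaining n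
  units.\<close>

lemma ex_dpl_0_1: "n \<ge> 1 \<Longrightarrow> \<exists>f. dpl f 0 1 0 (real n)"
proof (induction n rule: nat_induct_at_least)
  case base
  have "dpl (\<lambda>t. t) 0 1 0 1" by (intro dpl_id) auto
  then show ?case by auto
next
  case (Suc n)
  then obtain f where f: "dpl f 0 1 0 (real n)" by blast
  have half: "dyad (1/2)" using dyad_div_power2[of 1 1] by simp
  have "dpl (\<lambda>t. 0 + 2 powi 1 * (t - 0)) 0 (1/2) 0 1"
    using half by (intro dpl_affine_map) auto
  moreover have "dpl (\<lambda>t. 0 + 2 powi 1 * (t - 1/2)) (1/2) 1 0 1"
    using half by (intro dpl_affine_map) auto
  from dpl_comp[OF this f]
  have "dpl (\<lambda>t. f (0 + 2 powi 1 * (t - 1/2))) (1/2) 1 0 (real n)" .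
  moreover have "dpl (\<lambda>t. 1 + 2 powi 0 * (t - 0)) 0 (real n) 1 (real (Suc n))"
    using Suc.hyps dyad_of_int[of "int n"] by (intro dpl_affine_map) auto
  ultimately show ?case using dpl_comp dpl_glue_if by blast
qed

lemma ex_dpl_nat:
  assumes "1 \<le> p" "p \<le> q" shows "\<exists>f. dpl f 0 (real p) 0 (real q)"
proof -
  have dy: "dyad (real k)" for k using dyad_of_int[of "int k"] by simp
  obtain f where f: "dpl f 0 1 0 (real (q - p + 1))" using ex_dpl_0_1[of "q - p + 1"] by auto
  \<comment> \<open>Everything up to \<open>r\<close> is fixed; the last unit interval alone absorbs
    the excess length.\<close>
  define r where "r = real (p - 1)"
  have r: "0 \<le> r" "dyad r" "real p - r = 1" "real q - r = real (q - p + 1)"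
    unfolding r_def by (simp, rule dy) (use assms in \<open>simp_all add: of_nat_diff\<close>)
  have "r < real p" using r(3) by linarith
  then have 1: "dpl (\<lambda>t. 0 + 2 powi 0 * (t - r)) r (real p) 0 1"
    using r by (intro dpl_affine_map) (auto simp: dy)
  have 2: "dpl (\<lambda>t. r + 2 powi 0 * (t - 0)) 0 (real (q - p + 1)) r (real q)"
    by (rule dpl_affine_map) (use r(2,4) dy[of "q - p + 1"] in auto)
  from dpl_comp[OF dpl_comp[OF 1 f] 2] obtain g where g: "dpl g r (real p) r (real q)" by blast
  show ?thesis
  proof (cases "p = 1")
    case False
    then have "dpl (\<lambda>t. t) 0 r 0 r" using assms r(2) by (intro dpl_id) (auto simp: r_def)
    from dpl_glue_if[OF this g] show ?thesis by blast
  qed (use g in \<open>auto simp: r_def\<close>)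
qed

text \<open>Scaling by a common denominator makes both lengths integers; a contraction is obtained
  as the inverse of an expansion.\<close>

lemma ex_dpl:
  assumes "a < b" "c < d" "dyad a" "dyad b" "dyad c" "dyad d"
  shows "\<exists>f. dpl f a b c d"
proof -
  have "dyad (b - a)" "dyad (d - c)" using assms by (auto intro: dyad_intros)
  then obtain n1 n2 where n: "\<And>k. k \<ge> n1 \<Longrightarrow> \<exists>p::int. b - a = of_int p / 2 ^ k"
    "\<And>k. k \<ge> n2 \<Longrightarrow> \<exists>p::int. d - c = of_int p / 2 ^ k"
    by (metis dyadE)
  define k where "k = max n1 n2"
  obtain p q :: int where pq: "b - a = of_int p / 2 ^ k" "d - c = of_int q / 2 ^ k"
    using n[of k] unfolding k_def by auto
  have "0 < of_int p / (2::real) ^ k" "0 < of_int q / (2::real) ^ k"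
    using pq assms by (simp_all flip: pq)
  then have pos: "p > 0" "q > 0" by (simp_all add: zero_less_divide_iff)
  define p' q' where "p' = nat p" and "q' = nat q"
  have p': "1 \<le> p'" "1 \<le> q'" "real p' = of_int p" "real q' = of_int q"
    using pos by (auto simp: p'_def q'_def)
  have pw: "(2::real) powi int k = 2 ^ k" "(2::real) powi (- int k) = 1 / 2 ^ k"
    by (simp_all add: power_int_minus inverse_eq_divide)
  have 1: "dpl (\<lambda>t. 0 + 2 powi (int k) * (t - a)) a b 0 (real p')"
    using assms pq p' by (intro dpl_affine_map) (auto simp: pw)
  have 3: "dpl (\<lambda>t. c + 2 powi (- int k) * (t - 0)) 0 (real q') c d"
    using assms pq p' dyad_of_int[of q] by (intro dpl_affine_map) (auto simp: pw)
  obtain f where 2: "dpl f 0 (real p') 0 (real q')"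
  proof (cases "p' \<le> q'")
    case True
    then show thesis using ex_dpl_nat[of p' q'] p' that by blast
  next
    case False
    then obtain g where g: "dpl g 0 (real q') 0 (real p')" using ex_dpl_nat[of q' p'] p' by auto
    have "dpl (inv_into {0..real q'} g) 0 (real p') 0 (real q')"
      using dpl_bij_betw[OF g] by (intro dpl_inverse[OF g]) (auto simp: bij_betw_def)
    then show thesis using that by blast
  qed
  show ?thesis using dpl_comp[OF dpl_comp[OF 1 2] 3] by blast
qed

text \<open>Any pair of \<open>P\<close> cuts the rectangle into two smaller ones that contain all
  other pairs. The order condition also makes \<open>P\<close> single-valued and injective.\<close>

lemma ex_dpl_through:
  assumes "finite P" "a < b" "c < d" "dyad a" "dyad b" "dyad c" "dyad d"
    "\<And>p q. (p, q) \<in> P \<Longrightarrow> a < p \<and> p < b \<and> c < q \<and> q < d \<and> dyad p \<and> dyad q"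
    "\<And>p q p' q'. (p, q) \<in> P \<Longrightarrow> (p', q') \<in> P \<Longrightarrow> p < p' \<longleftrightarrow> q < q'"
  shows "\<exists>f. dpl f a b c d \<and> (\<forall>(p, q)\<in>P. f p = q)"
  using assms
proof (induction P arbitrary: a b c d rule: finite_psubset_induct)
  case (psubset P)
  show ?case
  proof (cases "P = {}")
    case True
    then show ?thesis using ex_dpl psubset.prems by blast
  next
    case False
    then obtain p q where pq: "(p, q) \<in> P" by auto
    note b = psubset.prems(7)[OF pq]
    define P1 P2 where "P1 = {z \<in> P. fst z < p}" and "P2 = {z \<in> P. p < fst z}"
    have "(p, q) \<notin> P1" "(p, q) \<notin> P2" by (simp_all add: P1_def P2_def)
    then have sub: "P1 \<subset> P" "P2 \<subset> P" using pq unfolding P1_def P2_def by blast+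
    have "\<exists>f. dpl f a p c q \<and> (\<forall>(x, y)\<in>P1. f x = y)"
    proof (rule psubset.IH[OF sub(1)])
      show "a < x \<and> x < p \<and> c < y \<and> y < q \<and> dyad x \<and> dyad y" if "(x, y) \<in> P1" for x y
        using that psubset.prems(7)[of x y] psubset.prems(8)[of x y p q] pq by (auto simp: P1_def)
      show "x < x' \<longleftrightarrow> y < y'" if "(x, y) \<in> P1" "(x', y') \<in> P1" for x y x' y'
        using that psubset.prems(8) by (auto simp: P1_def)
    qed (use b psubset.prems in auto)
    then obtain f where f: "dpl f a p c q" "\<forall>(x, y)\<in>P1. f x = y" by blast
    have "\<exists>f. dpl f p b q d \<and> (\<forall>(x, y)\<in>P2. f x = y)"
    proof (rule psubset.IH[OF sub(2)])
      show "p < x \<and> x < b \<and> q < y \<and> y < d \<and> dyad x \<and> dyad y" if "(x, y) \<in> P2" for x y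
        using that psubset.prems(7)[of x y] psubset.prems(8)[of p q x y] pq by (auto simp: P2_def)
      show "x < x' \<longleftrightarrow> y < y'" if "(x, y) \<in> P2" "(x', y') \<in> P2" for x y x' y'
        using that psubset.prems(8) by (auto simp: P2_def)
    qed (use b psubset.prems in auto)
    then obtain g where g: "dpl g p b q d" "\<forall>(x, y)\<in>P2. g x = y" by blast
    have "(if x \<le> p then f x else g x) = y" if xy: "(x, y) \<in> P" for x y
    proof -
      consider "x < p" | "p < x" | "x = p" by linarith
      then show ?thesis
      proof cases
        case 1
        then show ?thesis using f(2) xy by (auto simp: P1_def)
      next
        case 2
        then show ?thesis using g(2) xy by (auto simp: P2_def)
      next
        case 3
        then have "\<not> q < y" "\<not> y < q" using psubset.prems(8)[OF pq xy] psubset.prems(8)[OF xy pq] by auto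
        then show ?thesis using 3 dplD(8)[OF f(1)] by simp
      qed
    qed
    then show ?thesis using dpl_glue_if[OF f(1) g(1)] by blast
  qed
qed

lemma ex_thompson_F_through:
  assumes "finite P" "0 < \<delta>" "\<delta> < 1" "dyad \<delta>"
    "\<And>p q. (p, q) \<in> P \<Longrightarrow> 0 < p \<and> p < \<delta> \<and> 0 < q \<and> q < \<delta> \<and> dyad p \<and> dyad q"
    "\<And>p q p' q'. (p, q) \<in> P \<Longrightarrow> (p', q') \<in> P \<Longrightarrow> p < p' \<longleftrightarrow> q < q'"
  shows "\<exists>v\<in>carrier thompson_F. support v \<subseteq> {0..\<delta>} \<and> (\<forall>(p, q)\<in>P. v p = q)"
proof -
  obtain f where f: "dpl f 0 \<delta> 0 \<delta>" "\<forall>(p, q)\<in>P. f p = q"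
    using ex_dpl_through[of P 0 \<delta> 0 \<delta>] assms by auto
  define v where "v = (\<lambda>t\<in>{0..1}. if t \<le> \<delta> then f t else t)"
  have "dpl (\<lambda>t. if t \<le> \<delta> then f t else t) 0 1 0 1"
    using assms by (intro dpl_glue_if[OF f(1)] dpl_id) auto
  then have "dpl v 0 1 0 1" by (rule dpl_cong) (simp add: v_def)
  then have "v \<in> carrier thompson_F" by (simp add: carrier_thompson_F v_def)
  moreover have "support v \<subseteq> {0..\<delta>}"
    unfolding support_def by (rule closure_minimal) (auto simp: v_def split: if_splits)
  moreover have "v p = q" if "(p, q) \<in> P" for p q
    using that f(2) assms(3) assms(5)[OF that] by (auto simp: v_def)
  ultimately show ?thesis by blast
qed

section \<open>Exponent sums and letter counts\<close>

definition zero_exponent :: "letter list \<Rightarrow> int" where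
  "zero_exponent w = (\<Sum>x\<leftarrow>w. if fst x = 0 then lsgn x else 0)"

definition nonzero_count :: "letter list \<Rightarrow> nat" where
  "nonzero_count w = length (filter (\<lambda>x. fst x \<noteq> 0) w)"

lemma zero_exponent_simps [simp]:
  "zero_exponent [] = 0"
  "zero_exponent (x # w) = (if fst x = 0 then lsgn x else 0) + zero_exponent w"
  "zero_exponent (u @ v) = zero_exponent u + zero_exponent v"
  by (simp_all add: zero_exponent_def)

lemma nonzero_count_simps [simp]:
  "nonzero_count [] = 0"
  "nonzero_count (x # w) = (if fst x = 0 then 0 else 1) + nonzero_count w"
  "nonzero_count (u @ v) = nonzero_count u + nonzero_count v"
  by (simp_all add: nonzero_count_def)

lemma abs_zero_exponent_le: "\<bar>zero_exponent w\<bar> \<le> int (length w)"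
  by (induction w) (auto simp: lsgn_def)

lemma nonzero_count_le: "nonzero_count w \<le> length w"
  by (simp add: nonzero_count_def)

text \<open>With letters of index 0 only, the word is a single syllable, and a nonempty syllable of
  a reduced word has nonzero exponent.\<close>

lemma zero_exponent_eq_0_imp_Nil:
  assumes "reduced w" "nonzero_count w = 0" "zero_exponent w = 0"
  shows "w = []"
proof (rule ccontr)
  have "nonzero_count w = 0 \<Longrightarrow> lead0 0 w = zero_exponent w"
    by (induction w) (auto split: if_splits)
  then have 0: "lead0 0 w = 0" using assms by simp
  assume "w \<noteq> []"
  then obtain x v where w: "w = x # v" by (cases w) auto
  then have "fst x = 0" using assms(2) by (auto split: if_splits)
  then show False using lead_reduced[of x v 0 "(0, True)" 0] assms(1) 0 lsgn_cases[of x] w by auto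
qed

lemma append_Cons_eq_cases:
  assumes "u @ x # v = u' @ x' # v'"
  obtains "x = x'" "v = v'" | z where "v' = z @ x # v" | z where "v = z @ x' # v'"
  using assms by (auto simp: append_eq_append_conv2 append_eq_Cons_conv Cons_eq_append_conv)

lemma equal_nonzero_count_imp_eq:
  assumes "u @ x # v = u' @ x' # v'" "fst x \<noteq> 0" "fst x' \<noteq> 0" "nonzero_count v = nonzero_count v'"
  shows "x = x' \<and> v = v'"
  using assms(1) by (rule append_Cons_eq_cases) (use assms in auto)

text \<open>The letters strictly between the two positions all have index 0 and total exponent 0, so
  there are none; adjacent letters of a reduced word are not inverse to each other.\<close>

lemma consecutive_nonzero_letters:
  assumes "u @ x # v = u' @ x' # v'" "reduced (u @ x # v)" "fst x \<noteq> 0" "fst x = fst x'"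
    "nonzero_count v' = Suc (nonzero_count v)" "zero_exponent v = zero_exponent v'"
  shows "snd x = snd x'"
  using assms(1)
proof (rule append_Cons_eq_cases)
  fix z assume z: "v' = z @ x # v"
  then have "nonzero_count z = 0" "zero_exponent z = 0" using assms by auto
  moreover have red: "reduced (x' # z @ x # v)" using assms(1,2) z reduced_append[of u' "x' # v'"] by simp
  then have "reduced z" using reduced_append[of z "x # v"] by (simp add: reduced_Cons)
  ultimately have "z = []" by (intro zero_exponent_eq_0_imp_Nil)
  then have "x \<noteq> inv_letter x'" using red by (simp add: reduced_Cons)
  then show ?thesis using assms(4) by (auto simp: inv_letter_def prod_eq_iff)
qed (use assms in auto)

text \<open>
  Near \<open>0\<close> the map \<open>x\<^sub>0\<close> is \<open>t \<mapsto> t / 2\<close>, so it raises the level \<open>N\<close> by one and keeps the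
  code \<open>C\<close>.
\<close>

definition pt :: "nat \<Rightarrow> int \<Rightarrow> nat \<Rightarrow> real" where
  "pt K N C = 2 powi (- N) * (1 / 2 + (real C + 1) / 2 ^ Suc K)"

lemma pt_bounds:
  assumes "C + 1 < 2 ^ K"
  shows "2 powi (- N) / 2 < pt K N C" "pt K N C < 2 powi (- N)"
proof -
  have "real (C + 1) < real (2 ^ K)" using assms by (simp only: of_nat_less_iff)
  then have "0 < (real C + 1) / 2 ^ Suc K" "(real C + 1) / 2 ^ Suc K < 1 / 2"
    by (simp_all add: field_simps)
  moreover define a where "a = (real C + 1) / 2 ^ Suc K"
  ultimately have "0 < a" "a < 1 / 2" by simp_all
  then have "2 powi (- N) * (1 / 2) < pt K N C" "pt K N C < 2 powi (- N) * 1"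
    unfolding pt_def a_def[symmetric] by (intro mult_strict_left_mono; simp)+
  then show "2 powi (- N) / 2 < pt K N C" "pt K N C < 2 powi (- N)" by simp_all
qed

lemma pt_pos: "0 < pt K N C"
  unfolding pt_def by (intro mult_pos_pos add_pos_pos) auto

lemma pt_level_less:
  assumes "C + 1 < 2 ^ K" "C' + 1 < 2 ^ K" "N < N'"
  shows "pt K N' C' < pt K N C"
proof -
  have "(2::real) powi (- N') \<le> 2 powi (- N - 1)"
    using assms(3) by (intro power_int_increasing) auto
  also have "\<dots> = 2 powi (- N) / 2" by (simp add: power_int_diff)
  finally show ?thesis
    using pt_bounds(1)[OF assms(1), of N] pt_bounds(2)[OF assms(2), of N'] by linarith
qed

text \<open>Different levels occupy disjoint dyadic shells, of which the higher one is nearer to 0;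
  within a shell the code decides.\<close>

lemma pt_less_iff:
  assumes "C + 1 < 2 ^ K" "C' + 1 < 2 ^ K"
  shows "pt K N C < pt K N' C' \<longleftrightarrow> N' < N \<or> (N = N' \<and> C < C')"
proof -
  have "pt K N C < pt K N C' \<longleftrightarrow> C < C'"
    unfolding pt_def by (simp add: divide_less_cancel)
  then show ?thesis
    using pt_level_less[OF assms, of N N'] pt_level_less[OF assms(2,1), of N' N]
    by (cases N N' rule: linorder_cases) auto
qed

lemma dyad_pt: "dyad (pt K N C)"
proof -
  have "dyad ((of_int (int C + 1) + 2 ^ K) / 2 ^ Suc K)"
    using dyad_div_power2[of "int C + 1 + 2 ^ K" "Suc K"] by simp
  moreover have "(of_int (int C + 1) + 2 ^ K) / 2 ^ Suc K = 1 / 2 + (real C + 1) / 2 ^ Suc K"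
    by (simp add: field_simps)
  ultimately have "dyad (1 / 2 + (real C + 1) / 2 ^ Suc K)" by simp
  then show ?thesis unfolding pt_def by (rule dyad_mult[OF dyad_power_int])
qed

lemma pt_Suc_level: "pt K (N + 1) C = pt K N C / 2"
  by (simp add: pt_def power_int_diff)

text \<open>
  Every word gets its own range of codes, and the code increases by one at each letter of
  nonzero index. The partial maps that the letters of one index have to realise are increasing,
  because two letters that use adjacent pieces of a level in opposite directions would be
  separated by a power of \<open>x\<^sub>0\<close> of exponent \<open>0\<close>, and then cancel.
\<close>

lemma ex_admissible:
  assumes l: "l \<ge> 3" and e: "0 < e" "e < 1 / 2"
  shows "\<exists>v. admissible l m e v"
proof -
  define n where "n = 2 * m\<^sup>2"
  define W where "W = {w \<in> carrier (free_group (l - 1)). w \<noteq> [] \<and> length w \<le> n}"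
  have "W \<subseteq> {w. set w \<subseteq> {..<l - 1} \<times> UNIV \<and> length w \<le> n}"
    by (auto simp: W_def free_group_def)
  moreover have "finite {w::letter list. set w \<subseteq> {..<l - 1} \<times> UNIV \<and> length w \<le> n}"
    by (intro finite_lists_length_le finite_cartesian_product) auto
  ultimately have "finite W" by (rule finite_subset)
  then obtain c and r :: "letter list \<Rightarrow> nat" where r: "r ` W = {i. i < c}" "inj_on r W"
    using finite_imp_inj_to_nat_seg by metis
  \<comment> \<open>Each of the \<open>c\<close> words owns a block of \<open>Suc n\<close> codes,
    one for every possible number of nonzero-index letters in a suffix. Division with remainder by
    \<open>Suc n\<close> recovers the word and this number.\<close>
  define B where "B = c * Suc n"
  define code where "code w v = r w * Suc n + nonzero_count v" for w v
  obtain K where K: "B + 1 < 2 ^ K"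
    using less_exp[of "B + 1"] by blast
  \<comment> \<open>The interpolating maps have support in a closed interval, whose end must be
    dyadic and strictly below \<open>e\<close>.\<close>
  obtain L where L: "(1 / 2) ^ L < e" using real_arch_pow_inv[of e "1 / 2"] e by auto
  define \<delta> :: real where "\<delta> = (1 / 2) ^ L"
  have \<delta>: "0 < \<delta>" "\<delta> < e" "dyad \<delta>" "\<delta> = 2 powi (- int L)"
    using L dyad_div_power2[of 1 L] by (auto simp: \<delta>_def power_one_over power_int_minus inverse_eq_divide)
  \<comment> \<open>The paths start n levels below the shells next to \<delta>, so that n letters
    cannot lift them above level \<open>L\<close>.\<close>
  define N0 where "N0 = int (L + n)"
  define level where "level v = N0 + zero_exponent v" for v
  have suffix: "reduced w" "length v \<le> n" "int L \<le> level v" "level v \<in> {0..2 * N0}" "code w v < B" "code w v + 1 < 2 ^ K"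
    if "w \<in> W" "w = u @ v" for u v w
  proof -
    show "reduced w" using that(1) by (simp add: W_def free_group_def)
    show len: "length v \<le> n" using that by (auto simp: W_def)
    then show "int L \<le> level v" "level v \<in> {0..2 * N0}"
      using abs_zero_exponent_le[of v] by (auto simp: level_def N0_def)
    have "r w < c" using r(1) that(1) by blast
    then have "Suc (r w) * Suc n \<le> B" unfolding B_def by (intro mult_le_mono1) simp
    moreover have "nonzero_count v < Suc n" using nonzero_count_le[of v] len by simp
    ultimately show "code w v < B" by (simp add: code_def)
    then show "code w v + 1 < 2 ^ K" using K by simp
  qed
  have code_inj: "w = w' \<and> nonzero_count v = nonzero_count v'"
    if "w \<in> W" "w = u @ v" "w' \<in> W" "w' = u' @ v'" "code w v = code w' v'" for u v w u' v' w'
  proof -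
    have "nonzero_count v < Suc n" "nonzero_count v' < Suc n"
      using suffix(2)[OF that(1,2)] suffix(2)[OF that(3,4)] nonzero_count_le[of v] nonzero_count_le[of v']
      by linarith+
    then have "r w = code w v div Suc n" "nonzero_count v = code w v mod Suc n"
      "r w' = code w' v' div Suc n" "nonzero_count v' = code w' v' mod Suc n"
      unfolding code_def by (simp_all del: mult_Suc_right)
    then have "r w = r w'" "nonzero_count v = nonzero_count v'" using that(5) by simp_all
    then show ?thesis using r(2) that(1,3) by (auto simp: inj_on_def)
  qed
  \<comment> \<open>A demand on letter \<open>i\<close>: some word, after its suffix
    \<open>v\<close> has acted, sits at level \<open>N\<close> with code \<open>C\<close>, and the
    letter has to raise the code by one.\<close>
  define step where "step i s N C \<longleftrightarrow>
    (\<exists>w\<in>W. \<exists>u v. w = u @ (i, s) # v \<and> N = level v \<and> C = code w v)" for i s N C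
  have step_bounds: "int L \<le> N" "N \<in> {0..2 * N0}" "C + 1 < 2 ^ K" "C + 2 < 2 ^ K" "C + 1 \<le> B"
    if i: "i \<noteq> 0" and st: "step i s N C" for i s N C
  proof -
    obtain w u v where w: "w \<in> W" "w = u @ (i, s) # v" "N = level v" "C = code w v"
      using st by (auto simp: step_def)
    then have "w = (u @ [(i, s)]) @ v" by simp
    note b = suffix[OF w(1) this] suffix[OF w(1,2)]
    show "int L \<le> N" "N \<in> {0..2 * N0}" "C + 1 < 2 ^ K" using b w by auto
    have "C + 1 < B" using b(11) i w(4) by (simp add: code_def)
    then show "C + 2 < 2 ^ K" "C + 1 \<le> B" using K by simp_all
  qed
  have step_unique: "N = N' \<and> s = s'"
    if i: "i \<noteq> 0" and st: "step i s N C" "step i s' N' C" for i s s' N N' C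
  proof -
    obtain w u v where w: "w \<in> W" "w = u @ (i, s) # v" "N = level v" "C = code w v"
      using st(1) by (auto simp: step_def)
    obtain w' u' v' where w': "w' \<in> W" "w' = u' @ (i, s') # v'" "N' = level v'" "C = code w' v'"
      using st(2) by (auto simp: step_def)
    have "w = w' \<and> nonzero_count v = nonzero_count v'"
      using w w' by (intro code_inj[of w "u @ [(i, s)]" v w' "u' @ [(i, s')]" v']) auto
    then show ?thesis
      using equal_nonzero_count_imp_eq[of u "(i, s)" v u' "(i, s')" v'] w w' i by auto
  qed
  have step_consecutive: "s = s'"
    if i: "i \<noteq> 0" and st: "step i s N C" "step i s' N (Suc C)" for i s s' N C
  proof -
    obtain w u v where w: "w \<in> W" "w = u @ (i, s) # v" "N = level v" "C = code w v"
      using st(1) by (auto simp: step_def)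
    obtain w' u' v' where w': "w' \<in> W" "w' = u' @ (i, s') # v'" "N = level v'" "Suc C = code w' v'"
      using st(2) by (auto simp: step_def)
    have "code w ((i, s) # v) = code w' v'" using w w' i by (simp add: code_def)
    then have "w = w' \<and> nonzero_count ((i, s) # v) = nonzero_count v'"
      using w w' by (intro code_inj[of w u "(i, s) # v" w' "u' @ [(i, s')]" v']) auto
    then show ?thesis
      using consecutive_nonzero_letters[of u "(i, s)" v u' "(i, s')" v'] w w' i suffix(1)[OF w(1,2)]
      by (auto simp: level_def)
  qed
  \<comment> \<open>A negative letter acts through the inverse of the map of index \<open>i\<close>,
    so its demand is recorded with source and target exchanged.\<close>
  define P where "P i = {(pt K N (if s then C else Suc C), pt K N (if s then Suc C else C)) | s N C. step i s N C}" for i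
  have "\<exists>v\<in>carrier thompson_F. support v \<subseteq> {0..\<delta>} \<and> (\<forall>(p, q)\<in>P i. v p = q)" if i: "i \<noteq> 0" for i
  proof (rule ex_thompson_F_through)
    let ?D = "(\<lambda>(N, C). pt K N C) ` ({0..2 * N0} \<times> {..B})"
    have "P i \<subseteq> ?D \<times> ?D"
    proof
      fix z assume "z \<in> P i"
      then obtain s N C where z: "z = (pt K N (if s then C else Suc C), pt K N (if s then Suc C else C))"
        and st: "step i s N C" by (auto simp: P_def)
      have "(N, C) \<in> {0..2 * N0} \<times> {..B}" "(N, Suc C) \<in> {0..2 * N0} \<times> {..B}"
        using step_bounds[OF i st] by auto
      then have "pt K N C \<in> ?D" "pt K N (Suc C) \<in> ?D" by force+
      then show "z \<in> ?D \<times> ?D" using z by auto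
    qed
    then show "finite (P i)" by (rule finite_subset) auto
    show "0 < \<delta>" "\<delta> < 1" "dyad \<delta>" using \<delta> e by auto
    have in_range: "0 < pt K N C \<and> pt K N C < \<delta> \<and> dyad (pt K N C)" if "int L \<le> N" "C + 1 < 2 ^ K" for N C
    proof -
      have "(2::real) powi (- N) \<le> 2 powi (- int L)" using that(1) by (intro power_int_increasing) auto
      then show ?thesis using pt_pos[of K N C] dyad_pt pt_bounds(2)[OF that(2), of N] \<delta>(4) by auto
    qed
    show "0 < p \<and> p < \<delta> \<and> 0 < q \<and> q < \<delta> \<and> dyad p \<and> dyad q" if pq: "(p, q) \<in> P i" for p q
    proof -
      obtain s N C where pq: "p = pt K N (if s then C else Suc C)" "q = pt K N (if s then Suc C else C)"
        and st: "step i s N C" using pq by (auto simp: P_def)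
      have "int L \<le> N" "C + 1 < 2 ^ K" "Suc C + 1 < 2 ^ K" using step_bounds[OF i st] by auto
      then show ?thesis using pq in_range by auto
    qed
    show "p < p' \<longleftrightarrow> q < q'" if pq: "(p, q) \<in> P i" and pq': "(p', q') \<in> P i" for p q p' q'
    proof -
      obtain s N C where pq: "p = pt K N (if s then C else Suc C)" "q = pt K N (if s then Suc C else C)"
        and st: "step i s N C" using pq by (auto simp: P_def)
      obtain s' N' C' where pq': "p' = pt K N' (if s' then C' else Suc C')" "q' = pt K N' (if s' then Suc C' else C')"
        and st': "step i s' N' C'" using pq' by (auto simp: P_def)
      have b: "C + 1 < 2 ^ K" "Suc C + 1 < 2 ^ K" "C' + 1 < 2 ^ K" "Suc C' + 1 < 2 ^ K"
        using step_bounds(3,4)[OF i st] step_bounds(3,4)[OF i st'] by auto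
      then have iff: "p < p' \<longleftrightarrow> N' < N \<or> (N = N' \<and> (if s then C else Suc C) < (if s' then C' else Suc C'))"
        "q < q' \<longleftrightarrow> N' < N \<or> (N = N' \<and> (if s then Suc C else C) < (if s' then Suc C' else C'))"
        unfolding pq pq' by (intro pt_less_iff; simp)+
      show ?thesis
      \<comment> \<open>The two comparisons can differ only for opposite signs on one level with
        equal or adjacent codes.\<close>
      proof (cases "N = N' \<and> s \<noteq> s'")
        case True
        then have "C \<noteq> C'" "C' \<noteq> Suc C" "C \<noteq> Suc C'"
          using step_unique[OF i] step_consecutive[OF i] st st' by blast+
        then show ?thesis unfolding iff using True by auto
      qed (auto simp: iff)
    qed
  qed
  then obtain g where g: "\<And>i. i \<noteq> 0 \<Longrightarrow> g i \<in> carrier thompson_F \<and> support (g i) \<subseteq> {0..\<delta>} \<and> (\<forall>(p, q)\<in>P i. g i p = q)"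
    by metis
  let ?gs = "thompson_x0 # map g [1..<l-1]"
  have gs: "set ?gs \<subseteq> carrier thompson_F" "length ?gs = l - 1"
    using g thompson_x0_in_F l by auto
  have pt_range: "pt K (level v) (code w v) \<in> {0..<e}" "pt K (level v) (code w v) \<le> 1 / 4 * 2"
    if "w \<in> W" "w = u @ v" for u v w
  proof -
    have "(2::real) powi (- level v) \<le> 2 powi (- int L)"
      using suffix(3)[OF that] by (intro power_int_increasing) auto
    then have "pt K (level v) (code w v) < e"
      using pt_bounds(2)[OF suffix(6)[OF that], of "level v"] \<delta> by linarith
    then show "pt K (level v) (code w v) \<in> {0..<e}" "pt K (level v) (code w v) \<le> 1 / 4 * 2"
      using pt_pos[of K "level v" "code w v"] e by auto
  qed
  have track: "word_eval thompson_F ?gs v (pt K N0 (code w [])) = pt K (level v) (code w v)"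
    if "w \<in> W" "w = u @ v" for w u v
    using that
  proof (induction v arbitrary: u)
    case Nil
    then show ?case
      using pt_range[of w w "[]"] e by (simp add: level_def thompson_F_one_apply)
  next
    case (Cons x v)
    obtain i s where x: "x = (i, s)" by (cases x)
    have wv: "w = (u @ [x]) @ v" using Cons.prems by simp
    have IH: "word_eval thompson_F ?gs v (pt K N0 (code w [])) = pt K (level v) (code w v)"
      using Cons.IH[OF Cons.prems(1) wv] .
    let ?p = "pt K (level v) (code w v)" and ?q = "pt K (level (x # v)) (code w (x # v))"
    note pr = pt_range[OF Cons.prems(1) wv] pt_range[OF Cons.prems]
    have idx: "fst ` set w \<subseteq> {..<l - 1}" using Cons.prems(1) by (auto simp: W_def free_group_def)
    have i: "i < l - 1" and v: "fst ` set v \<subseteq> {..<length ?gs}"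
      using idx wv x gs(2) by auto
    let ?h = "?gs ! i"
    have h: "?h \<in> carrier thompson_F" using gs i by (metis nth_mem subsetD)
    let ?f = "if s then ?h else inv\<^bsub>thompson_F\<^esub> ?h"
    have p0: "pt K N0 (code w []) \<in> {0..1}"
      using pt_range[of w w "[]"] Cons.prems(1) e by (simp add: level_def)
    have f: "?f \<in> carrier thompson_F" using h by (cases s) auto
    have "word_eval thompson_F ?gs (x # v) (pt K N0 (code w [])) = ?f ?p"
      by (simp only: TF.word_eval_Cons x fst_conv snd_conv
          thompson_F_mult_apply[OF f TF.word_eval_closed[OF gs(1) v] p0] IH)
    also have "?f ?p = ?q"
    proof -
      \<comment> \<open>Both signs become one equation for the generator itself, with the two points
        exchanged for an inverse letter.\<close>
      have "?h (if s then ?p else ?q) = (if s then ?q else ?p)"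
      proof (cases "i = 0")
        case True
        have c: "code w (x # v) = code w v" using True x by (simp add: code_def)
        have "level (x # v) = (if s then level v + 1 else level v - 1)"
          using True x by (simp add: level_def lsgn_def)
        then have "(if s then ?q else ?p) = (if s then ?p else ?q) / 2"
          unfolding c using pt_Suc_level[of K "level (x # v)" "code w v"] pt_Suc_level[of K "level v" "code w v"]
          by (cases s) simp_all
        moreover have "(if s then ?p else ?q) \<in> {0..1/2}" using pr e by auto
        ultimately show ?thesis using True by (simp add: thompson_x0_def)
      next
        case False
        have lc: "level (x # v) = level v" "code w (x # v) = Suc (code w v)"
          using False x by (simp_all add: level_def code_def)
        have st: "step i s (level v) (code w v)"
          unfolding step_def using Cons.prems x by blast
        have "((if s then ?p else ?q), (if s then ?q else ?p)) \<in> P i"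
          unfolding P_def lc mem_Collect_eq using st
          by (intro exI[of _ s] exI[of _ "level v"] exI[of _ "code w v"]) (cases s; simp)
        moreover have "g i p = q" if "(p, q) \<in> P i" for p q using g[OF False] that by auto
        ultimately have "g i (if s then ?p else ?q) = (if s then ?q else ?p)" by blast
        moreover have "?h = g i" using False i by (simp add: nth_Cons' del: upt_Suc)
        ultimately show ?thesis by simp
      qed
      then show ?thesis
        using thompson_F_inv_apply(1)[OF h, of ?q] pr e by (cases s) auto
    qed
    finally show ?case .
  qed
  have "admissible l m e g"
    unfolding admissible_def
  proof (intro conjI ballI impI)
    fix i assume "i \<in> {1..l - 2}"
    then have "i \<noteq> 0" by simp
    from g[OF this] show "g i \<in> carrier thompson_F" "support (g i) \<subseteq> {0..<e}" using \<delta> by auto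
  next
    fix w assume w: "w \<in> carrier (free_group (l - 1))"
      "w \<noteq> \<one>\<^bsub>free_group (l - 1)\<^esub> \<and> length w \<le> 2 * m\<^sup>2"
    then have wW: "w \<in> W" by (simp add: W_def n_def) (simp add: free_group_def)
    let ?t = "pt K N0 (code w [])"
    have t: "?t \<in> {0..<e}" using pt_range(1)[OF wW, of w "[]"] by (simp add: level_def)
    have b: "code w [] + 1 < 2 ^ K" "code w w + 1 < 2 ^ K"
      using suffix(6)[OF wW, of w "[]"] suffix(6)[OF wW, of "[]" w] by auto
    \<comment> \<open>Returning to the start would mean the same level and the same code: exponent 0
      in x_0 and no other letters, which leaves only the empty word.\<close>
    have "pt K (level w) (code w w) \<noteq> ?t"
    proof
      assume eq: "pt K (level w) (code w w) = ?t"
      then have "\<not> pt K (level w) (code w w) < ?t" "\<not> ?t < pt K (level w) (code w w)" by simp_all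
      then have "level w = N0" "code w w = code w []"
        unfolding pt_less_iff[OF b] pt_less_iff[OF b(2,1)] by linarith+
      then have "nonzero_count w = 0" "zero_exponent w = 0" by (simp_all add: level_def code_def)
      moreover have "reduced w" "w \<noteq> []" using wW by (auto simp: W_def free_group_def)
      ultimately show False using zero_exponent_eq_0_imp_Nil by blast
    qed
    then have "word_eval thompson_F ?gs w ?t \<noteq> ?t" using track[OF wW, of "[]" w] by simp
    then show "\<exists>t\<in>{0..<e}. word_eval thompson_F ?gs w t \<noteq> t" using t by blast
  qed
  then show ?thesis by blast
qed

theorem corollary3p7:
  fixes l :: nat
  assumes "l \<ge> 3"
  shows "(\<forall>m\<ge>1. \<forall>e::real. 0 < e \<and> e < 1/2 \<and> 2 ^ (m\<^sup>2) * e < 1/2 \<longrightarrow> (\<exists>v. admissible l m e v))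
    \<and> (\<forall>(\<epsilon> :: nat \<Rightarrow> real) (u :: nat \<Rightarrow> nat \<Rightarrow> real \<Rightarrow> real).
         (\<forall>m\<ge>1. 0 < \<epsilon> m \<and> \<epsilon> m < 1/2 \<and> 2 ^ (m\<^sup>2) * \<epsilon> m < 1/2
            \<and> admissible l m (\<epsilon> m) (\<lambda>i. u i m)) \<longrightarrow>
         (\<forall>m\<ge>1. marked_group l (F_marking l m (\<lambda>i. u i m)))
         \<and> marked_group l (free_group l, free_basis l)
         \<and> (\<lambda>m. marked_dist l (F_marking l m (\<lambda>i. u i m)) (free_group l, free_basis l))
              \<longlonglongrightarrow> 0)"
proof (intro conjI allI impI)
  fix m :: nat and e :: real
  assume "1 \<le> m" "0 < e \<and> e < 1/2 \<and> 2 ^ (m\<^sup>2) * e < 1/2"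
  then show "\<exists>v. admissible l m e v" using ex_admissible[OF assms] by blast
next
  fix \<epsilon> :: "nat \<Rightarrow> real" and u :: "nat \<Rightarrow> nat \<Rightarrow> real \<Rightarrow> real"
  assume adm: "\<forall>m\<ge>1. 0 < \<epsilon> m \<and> \<epsilon> m < 1/2 \<and> 2 ^ (m\<^sup>2) * \<epsilon> m < 1/2
            \<and> admissible l m (\<epsilon> m) (\<lambda>i. u i m)"
  show "marked_group l (F_marking l m (\<lambda>i. u i m))" if "1 \<le> m" for m
    using adm that by (intro marked_group_F_marking[OF assms]) (auto simp: admissible_def)
  show "marked_group l (free_group l, free_basis l)" by (rule marked_group_free_group)
  show "(\<lambda>m. marked_dist l (F_marking l m (\<lambda>i. u i m)) (free_group l, free_basis l)) \<longlonglongrightarrow> 0"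
    using adm by (intro F_marking_converges[OF assms, of \<epsilon>]) auto
qed

end
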